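(* Let $d\ge 2$ and $1\le k<d$ be integers, and let $E\subseteq\mathbb{R}^d$ be a compact $(d,k)$-set. If $k\le d/2$, then $$\dim_{\mathrm F}E\ge 2k.$$ Otherwise, if $k>d/2$, then $\dim_{\mathrm F}E=d$ and $E$ has positive $d$-dimensional Lebesgue measure.
   Context: $G(d,k)$ is the Grassmannian of all $k$-dimensional linear subspaces of $\mathbb{R}^d$. To each $s\in G(d,k)$ associate, once and for all, an orthonormal basis $\{x_1^s,\dots,x_k^s\}\subseteq\mathbb{R}^d$ of $s$; the specific choice is irrelevant. A set $E\subseteq\mathbb{R}^d$ is a $(d,k)$-set if for all $s\in G(d,k)$ there exists $t_s\in\mathbb{R}^d$ such that $t_s+\sum_{i=1}^k r_i x_i^s\in E$ for all $(r_1,\dots,r_k)\in[0,1]^k$. Fourier dimension: for a Borel measure $\mu$ on $\mathbb{R}^d$, $\hat\mu(\xi)=\int_{\mathbb{R}^d} e^{-2\pi i\xi\cdot x}\,d\mu(x)$. For a closed set $E\subseteq\mathbb{R}^d$, $\dim_{\mathrm F}E$ is the supremum of those $s\in[0,d]$ for which there exist a Borel probability measure $\mu$ supported on $E$ and a constant $C>0$ with $|\hat\mu(\xi)|\le C|\xi|^{-s/2}$ for all $\xi\in\mathbb{R}^d\setminus\{0\}$. *)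

theory Defs
  imports "HOL-Probability.Probability"
begin

definition grassmannian :: "nat \<Rightarrow> (real ^ 'n) set set" where
  "grassmannian k = {s. subspace s \<and> dim s = k}"

(* x assigns to each k-dimensional subspace s an orthonormal basis x s 1, ..., x s k of s;
   values at other subspaces and other indices are unconstrained. *)
definition orthonormal_basis_choice ::
    "nat \<Rightarrow> ((real ^ 'n) set \<Rightarrow> nat \<Rightarrow> real ^ 'n) \<Rightarrow> bool" where
  "orthonormal_basis_choice k x \<longleftrightarrow>
     (\<forall>s\<in>grassmannian k.
        (\<forall>i\<in>{1..k}. \<forall>j\<in>{1..k}. x s i \<bullet> x s j = (if i = j then 1 else 0)) \<and>
        span (x s ` {1..k}) = s)"

(* (d,k)-sets in R^d, where d = CARD('n), relative to the choice x of orthonormal bases. *)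
definition dk_set ::
    "((real ^ 'n) set \<Rightarrow> nat \<Rightarrow> real ^ 'n) \<Rightarrow> nat \<Rightarrow> (real ^ 'n) set \<Rightarrow> bool" where
  "dk_set x k E \<longleftrightarrow>
     (\<forall>s\<in>grassmannian k. \<exists>t. \<forall>r :: nat \<Rightarrow> real.
        (\<forall>i\<in>{1..k}. r i \<in> {0..1}) \<longrightarrow> t + (\<Sum>i=1..k. r i *\<^sub>R x s i) \<in> E)"

definition fourier_transform :: "(real ^ 'n) measure \<Rightarrow> real ^ 'n \<Rightarrow> complex" where
  "fourier_transform \<mu> \<xi> = (LINT x|\<mu>. exp (- 2 * pi * \<i> * complex_of_real (\<xi> \<bullet> x)))"

(* Meant for closed E, where "supported on E" says that the complement of E is a null set.
   For nonempty closed E the set below contains 0 (take a point mass) and is bounded above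
   by CARD('n), so Sup is a genuine supremum; the value at the empty set is not meaningful. *)
definition fourier_dim :: "(real ^ 'n) set \<Rightarrow> real" where
  "fourier_dim E = Sup {s \<in> {0..real CARD('n)}.
     \<exists>\<mu> C. prob_space \<mu> \<and> sets \<mu> = sets borel \<and> emeasure \<mu> (- E) = 0 \<and> C > 0 \<and>
       (\<forall>\<xi>. \<xi> \<noteq> 0 \<longrightarrow> cmod (fourier_transform \<mu> \<xi>) \<le> C * norm \<xi> powr (- s / 2))}"

end

theory Submission
  imports Defs
begin

text \<open>
  Let $v_0,\dots,v_{k-1}$ be vectors of length at most $1/(2k)$. They lie in a common
  $k$-dimensional subspace, and every combination $\sum_i r_i v_i$ with $r_i\in[0,1]$ has norm at
  most $1/2$; so, measured from the centre of the unit cube that $E$ contains in that subspace, the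
  whole parallelepiped $\{\sum_i r_i v_i\}$ stays inside the cube. Hence there is a translation
  $t_v$ with $t_v+\sum_i r_i v_i\in E$ for all $r\in[0,1]^k$. This replaces the Grassmannian with
  its arbitrary bases by independent vectors in a ball.

  Choose $v_0,\dots,v_{k-1}$ independently and uniformly in the ball of radius $1/(2k)$, choose the
  $r_i$ independently with density $6r(1-r)$ on $[0,1]$, and let $\mu$ be the law of
  $t_v+\sum_i r_i v_i$, a probability measure on $E$. Given $v$, the translation contributes only a
  phase, so that
  \[ |\hat\mu(\xi)| \le \prod_{i<k} \int |\hat\rho(\xi\cdot v_i)|\,dv_i, \]
  where $\rho$ is the law of one $r_i$. As $\hat\rho$ is integrable over the line and $\xi\cdot v$
  spreads over a length comparable to $|\xi|$, each factor is $O(1/|\xi|)$, and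
  $|\hat\mu(\xi)|=O(|\xi|^{-k})$ (\<open>dk_set_carries_decaying_measure\<close>). For $2k\le d$ this is the
  claimed bound, and for $2k>d$ it gives dimension $d$. The definition of $\mu$ requires $v\mapsto t_v$
  to be measurable; \<open>closed_set_borel_selection\<close> provides this, since the admissible pairs
  $(v,t)$ form a closed set with $t$ in the compact set $E$.

  If $2k>d$, then $|\hat\mu|^2$ is integrable, because $2k\ge d+1$. The law $\nu$ of the difference of
  two independent $\mu$-distributed points has transform $|\hat\mu|^2$. Pairing $\nu$ with the
  difference law of the uniform measure on a ball of radius $R$ shows that the ball of radius
  $1/(6R)$ around $0$ has $\nu$-measure $O(R^{-d})$ (\<open>difference_law_cball_le\<close>). On the other hand,
  the Cauchy--Schwarz inequality for $x\mapsto\mu(B(x,r))$ bounds $|B(0,r)|$ by $\nu(B(0,2r))$ times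
  the volume of the $r$-neighbourhood of $E$ (\<open>emeasure_neighbourhood_ge\<close>). With $R=1/(12r)$ both
  bounds scale in the same way, so every neighbourhood of $E$ has volume at least a fixed positive
  number, and $E$ cannot be a null set.
\<close>

section \<open>Borel selection from compact sets\<close>

text \<open>
  A random nonempty compact set in the sense of Castaing and Kuratowski--Ryll-Nardzewski:
  measurability is required of the events that the set meets a given closed set. Hitting events are
  stable under the passage to minimisers, which would not be clear for a description by the graph.
\<close>
definition borel_compact_field :: "'m measure \<Rightarrow> ('m \<Rightarrow> 'a::euclidean_space set) \<Rightarrow> bool" where
  "borel_compact_field M F \<longleftrightarrow>
     (\<forall>w\<in>space M. compact (F w) \<and> F w \<noteq> {}) \<and>
     (\<forall>K. closed K \<longrightarrow> {w\<in>space M. F w \<inter> K \<noteq> {}} \<in> sets M)"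

text \<open>
  Passing to the minimisers of a continuous function loses no measurability: the minimum $m(w)$ is
  at most $q$ iff the set meets $\{f\le q\}$, and the set of minimisers meets $K$ iff, for every
  rational $q$, meeting $\{f\le q\}$ at all forces meeting $K\cap\{f\le q\}$. Compactness turns
  the second condition, which involves only rational $q\ge m(w)$, into one at $m(w)$ itself.
\<close>
lemma borel_compact_field_minimise:
  fixes F :: "'m \<Rightarrow> 'a::euclidean_space set" and f :: "'a \<Rightarrow> real"
  assumes F: "borel_compact_field M F" and f: "continuous_on UNIV f"
  obtains G m where "borel_compact_field M G" "m \<in> borel_measurable M"
    "\<And>w. w \<in> space M \<Longrightarrow> G w \<subseteq> F w" "\<And>w t. w \<in> space M \<Longrightarrow> t \<in> G w \<Longrightarrow> f t = m w"
proof -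
  have comp: "compact (F w)" "F w \<noteq> {}" if "w \<in> space M" for w
    using F that by (auto simp: borel_compact_field_def)
  have hit: "{w\<in>space M. F w \<inter> K \<noteq> {}} \<in> sets M" if "closed K" for K
    using F that by (auto simp: borel_compact_field_def)
  define sub where "sub q = {t. f t \<le> q}" for q
  have closed_sub: "closed (sub q)" for q
    unfolding sub_def using f by (intro closed_Collect_le continuous_on_const) 
  define m where "m w = Inf (f ` F w)" for w
  have att: "\<exists>t\<in>F w. f t = m w \<and> (\<forall>u\<in>F w. m w \<le> f u)" if w: "w \<in> space M" for w
  proof -
    obtain t where t: "t \<in> F w" "\<forall>u\<in>F w. f t \<le> f u"
      using continuous_attains_inf[OF comp(1)[OF w] comp(2)[OF w] continuous_on_subset[OF f subset_UNIV]] by blast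
    then have "m w = f t"
      unfolding m_def by (intro cInf_eq_minimum) auto
    with t show ?thesis by auto
  qed
  have m_le: "m w \<le> q \<longleftrightarrow> F w \<inter> sub q \<noteq> {}" if "w \<in> space M" for w q
    using att[OF that] unfolding sub_def by force
  have m: "m \<in> borel_measurable M"
    unfolding borel_measurable_iff_le
  proof
    fix q
    have "{w\<in>space M. m w \<le> q} = {w\<in>space M. F w \<inter> sub q \<noteq> {}}"
      using m_le by auto
    then show "{w\<in>space M. m w \<le> q} \<in> sets M"
      using hit[OF closed_sub] by simp
  qed
  define G where "G w = F w \<inter> sub (m w)" for w
  have hitG: "{w\<in>space M. G w \<inter> K \<noteq> {}} \<in> sets M" if K: "closed K" for K
  proof -
    have eq: "G w \<inter> K \<noteq> {} \<longleftrightarrow> (\<forall>q::rat. F w \<inter> sub (of_rat q) \<noteq> {} \<longrightarrow> F w \<inter> (K \<inter> sub (of_rat q)) \<noteq> {})"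
      if w: "w \<in> space M" for w
    proof
      assume "G w \<inter> K \<noteq> {}"
      then obtain t where t: "t \<in> F w" "t \<in> K" "f t \<le> m w"
        by (auto simp: G_def sub_def)
      show "\<forall>q::rat. F w \<inter> sub (of_rat q) \<noteq> {} \<longrightarrow> F w \<inter> (K \<inter> sub (of_rat q)) \<noteq> {}"
        using t m_le[OF w, symmetric] by (force simp: sub_def)
    next
      assume *: "\<forall>q::rat. F w \<inter> sub (of_rat q) \<noteq> {} \<longrightarrow> F w \<inter> (K \<inter> sub (of_rat q)) \<noteq> {}"
      then have q: "F w \<inter> (K \<inter> sub (of_rat q)) \<noteq> {}" if "m w \<le> of_rat q" for q
        using m_le[OF w] that by auto
      obtain q0 where "m w < of_rat q0"
        using of_rat_dense[of "m w" "m w + 1"] by auto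
      then have ne: "F w \<inter> K \<noteq> {}"
        using q[of q0] by auto
      have "compact (F w \<inter> K)"
        using comp(1)[OF w] K by (rule compact_Int_closed)
      then obtain t where t: "t \<in> F w \<inter> K" "\<forall>u\<in>F w \<inter> K. f t \<le> f u"
        using continuous_attains_inf[OF _ ne continuous_on_subset[OF f subset_UNIV]] by blast
      have "f t \<le> m w"
      proof (rule ccontr)
        assume "\<not> f t \<le> m w"
        then obtain q' where q': "m w < of_rat q'" "of_rat q' < f t"
          using of_rat_dense[of "m w" "f t"] by auto
        then obtain u where "u \<in> F w \<inter> K" "f u \<le> of_rat q'"
          using q[of q'] by (auto simp: sub_def)
        with t q' show False by force
      qed
      then show "G w \<inter> K \<noteq> {}"
        using t by (auto simp: G_def sub_def)
    qed
    have "{w\<in>space M. \<forall>q::rat. F w \<inter> sub (of_rat q) \<noteq> {} \<longrightarrow> F w \<inter> (K \<inter> sub (of_rat q)) \<noteq> {}} \<in> sets M"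
      by (intro sets.sets_Collect hit closed_sub closed_Int K)
    then show ?thesis
      using eq by (simp cong: conj_cong)
  qed
  have "borel_compact_field M G"
    unfolding borel_compact_field_def
  proof (intro conjI ballI allI impI hitG)
    fix w assume w: "w \<in> space M"
    show "compact (G w)"
      unfolding G_def using comp(1)[OF w] closed_sub by (rule compact_Int_closed)
    show "G w \<noteq> {}"
      using m_le[OF w, of "m w"] by (simp add: G_def)
  qed
  then show thesis
  proof (rule that[OF _ m])
    show "G w \<subseteq> F w" for w
      by (auto simp: G_def)
    show "f t = m w" if "w \<in> space M" "t \<in> G w" for w t
      using att[OF that(1)] that(2) by (force simp: G_def sub_def)
  qed
qed

text \<open>
  Minimising the coordinates one after the other shrinks each compact set to its lexicographically
  least point, whose coordinates are the successive minima and hence measurable.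
\<close>
lemma borel_compact_field_selection:
  fixes F :: "'m \<Rightarrow> 'a::euclidean_space set"
  assumes F: "borel_compact_field M F"
  obtains t where "t \<in> borel_measurable M" "\<And>w. w \<in> space M \<Longrightarrow> t w \<in> F w"
proof -
  have coords: "\<exists>G. borel_compact_field M G \<and> (\<forall>w\<in>space M. G w \<subseteq> F w) \<and>
      (\<forall>b\<in>B. \<exists>m\<in>borel_measurable M. \<forall>w\<in>space M. \<forall>t\<in>G w. t \<bullet> b = m w)"
    if "finite B" for B :: "'a set"
    using that
  proof (induction B)
    case empty
    then show ?case using F by auto
  next
    case (insert b B)
    then obtain G where G: "borel_compact_field M G" "\<And>w. w \<in> space M \<Longrightarrow> G w \<subseteq> F w"
      "\<forall>b\<in>B. \<exists>m\<in>borel_measurable M. \<forall>w\<in>space M. \<forall>t\<in>G w. t \<bullet> b = m w"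
      by blast
    have "continuous_on UNIV (\<lambda>t. t \<bullet> b)"
      by (intro continuous_intros)
    then obtain H m where H: "borel_compact_field M H" "m \<in> borel_measurable M"
      "\<And>w. w \<in> space M \<Longrightarrow> H w \<subseteq> G w" "\<And>w t. w \<in> space M \<Longrightarrow> t \<in> H w \<Longrightarrow> t \<bullet> b = m w"
      using borel_compact_field_minimise[OF G(1)] by blast
    show ?case
    proof (intro exI[of _ H] conjI ballI)
      fix c assume "c \<in> insert b B"
      then consider "c = b" | "c \<in> B" by auto
      then show "\<exists>m\<in>borel_measurable M. \<forall>w\<in>space M. \<forall>t\<in>H w. t \<bullet> c = m w"
      proof cases
        case 1
        then show ?thesis using H by auto
      next
        case 2
        then show ?thesis using G(3) H(3) by blast
      qed
    qed (use H G in blast)+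
  qed
  obtain G where G: "borel_compact_field M G" "\<And>w. w \<in> space M \<Longrightarrow> G w \<subseteq> F w"
    "\<forall>b\<in>Basis. \<exists>m. m \<in> borel_measurable M \<and> (\<forall>w\<in>space M. \<forall>t\<in>G w. t \<bullet> b = m w)"
    using coords[OF finite_Basis] unfolding Bex_def by (elim exE conjE) blast
  obtain m where m: "\<And>b. b \<in> Basis \<Longrightarrow> m b \<in> borel_measurable M"
    "\<And>b w t. b \<in> Basis \<Longrightarrow> w \<in> space M \<Longrightarrow> t \<in> G w \<Longrightarrow> t \<bullet> b = m b w"
    using bchoice[OF G(3)] by blast
  show thesis
  proof (rule that)
    show "(\<lambda>w. \<Sum>b\<in>Basis. m b w *\<^sub>R b) \<in> borel_measurable M"
      using m(1) by (intro borel_measurable_sum borel_measurable_scaleR) auto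
    fix w assume w: "w \<in> space M"
    then obtain t where t: "t \<in> G w"
      using G(1) by (auto simp: borel_compact_field_def)
    have "(\<Sum>b\<in>Basis. m b w *\<^sub>R b) = (\<Sum>b\<in>Basis. (t \<bullet> b) *\<^sub>R b)"
      using m(2)[OF _ w t] by simp
    also have "\<dots> = t"
      by (rule euclidean_representation)
    finally show "(\<Sum>b\<in>Basis. m b w *\<^sub>R b) \<in> F w"
      using t G(2)[OF w] by auto
  qed
qed

text \<open>
  The second components range in a compact set, so the parameters whose fibre meets a given closed
  set are the image of a closed set under a projection along a compact space, hence form a closed set. Empty fibres are filled
  with $0$ so that the selection theorem for nonempty sets applies.
\<close>
lemma closed_set_borel_selection:
  fixes C :: "('p::topological_space \<times> 'a::euclidean_space) set"
  assumes C: "closed C" and E: "compact E" and CE: "snd ` C \<subseteq> E"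
  obtains t where "t \<in> borel_measurable borel" "\<And>p u. (p, u) \<in> C \<Longrightarrow> (p, t p) \<in> C"
proof -
  define F where "F p = {u. (p, u) \<in> C}" for p
  have closed_F: "closed (F p)" for p
  proof -
    have "F p = Pair p -` C" by (auto simp: F_def)
    also have "closed \<dots>"
      by (intro closed_vimage C continuous_intros)
    finally show ?thesis .
  qed
  have closed_hit: "closed {p. F p \<inter> K \<noteq> {}}" if K: "closed K" for K
  proof -
    have "closed_map (prod_topology euclidean (top_of_set E)) euclidean (fst :: 'p \<times> 'a \<Rightarrow> 'p)"
      using E by (intro Abstract_Topological_Spaces.closed_map_fst) (simp add: compact_space_subtopology)
    moreover have "closedin (prod_topology euclidean (top_of_set E)) (C \<inter> UNIV \<times> K)"
    proof -
      have "prod_topology euclidean (top_of_set E) = top_of_set ((UNIV :: 'p set) \<times> E)"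
        by (simp add: prod_topology_subtopology flip: euclidean_product_topology)
      moreover have "closed (C \<inter> UNIV \<times> K)"
        using C K by (intro closed_Int closed_Times) auto
      moreover have "C \<inter> UNIV \<times> K \<subseteq> UNIV \<times> E"
        using CE by force
      ultimately show ?thesis
        by (simp add: closed_subset)
    qed
    ultimately have "closed (fst ` (C \<inter> UNIV \<times> K))"
      unfolding closed_map_def by force
    also have "fst ` (C \<inter> UNIV \<times> K) = {p. F p \<inter> K \<noteq> {}}"
      by (force simp: F_def)
    finally show ?thesis .
  qed
  define F' where "F' p = (if F p = {} then {0} else F p)" for p
  have "borel_compact_field borel F'"
    unfolding borel_compact_field_def
  proof (intro conjI ballI allI impI)
    fix p
    have "F p \<subseteq> E" using CE by (force simp: F_def)
    then have "compact (F p)"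
      using closed_F E by (metis compact_Int_closed inf.absorb2)
    then show "compact (F' p)"
      by (simp add: F'_def)
    show "F' p \<noteq> {}" by (simp add: F'_def)
  next
    fix K :: "'a set" assume K: "closed K"
    have 1: "{p. F p \<inter> K \<noteq> {}} \<in> sets borel" "{p. F p \<inter> UNIV \<noteq> {}} \<in> sets borel"
      by (intro borel_closed closed_hit K closed_UNIV)+
    have "{p\<in>space borel. F' p \<inter> K \<noteq> {}} =
        {p. F p \<inter> K \<noteq> {}} \<union> (if 0 \<in> K then - {p. F p \<inter> UNIV \<noteq> {}} else {})"
      by (auto simp: F'_def)
    also have "\<dots> \<in> sets borel"
      using 1 by auto
    finally show "{p\<in>space borel. F' p \<inter> K \<noteq> {}} \<in> sets borel" .
  qed
  then obtain t where "t \<in> borel_measurable borel" "\<And>p. t p \<in> F' p"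
    by (rule borel_compact_field_selection) auto
  then show thesis
    by (intro that[of t]) (force simp: F'_def F_def split: if_splits)+
qed

section \<open>Parallelepipeds inside a $(d,k)$-set\<close>

text \<open>
  The vectors need not be independent, so their span may be too small; it is enlarged by further
  elements of a basis of the whole space.
\<close>
lemma subspace_of_dim_containing:
  fixes V :: "'a::euclidean_space set"
  assumes V: "finite V" "card V \<le> k" and k: "k \<le> DIM('a)"
  obtains s where "subspace s" "dim s = k" "V \<subseteq> s"
proof -
  obtain B where B: "B \<subseteq> V" "independent B" "V \<subseteq> span B"
    using maximal_independent_subset[of V] by blast
  obtain D where D: "B \<subseteq> D" "independent D" "UNIV \<subseteq> span D"
    using maximal_independent_subset_extend[of B UNIV] B(2) by auto
  have "card B \<le> k"
    using card_mono[OF V(1) B(1)] V(2) by simp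
  moreover have "finite D" "card D = DIM('a)"
    using D independent_imp_finite dim_eq_card_independent[OF D(2)] dim_span[of D] dim_UNIV
    by (auto simp: top.extremum_unique) 
  ultimately obtain C where C: "B \<subseteq> C" "C \<subseteq> D" "card C = k"
    using exists_subset_between[of B k D] D(1) k by auto
  show thesis
  proof (rule that)
    show "dim (span C) = k"
      using C D(2) independent_mono dim_span_eq_card_independent by metis
    show "V \<subseteq> span C"
      using B(3) C(1) span_mono by blast
  qed (rule subspace_span)
qed

lemma sum_orthonormal_representation:
  fixes b :: "'i \<Rightarrow> 'a::real_inner"
  assumes I: "finite I" and on: "\<And>i j. i \<in> I \<Longrightarrow> j \<in> I \<Longrightarrow> b i \<bullet> b j = (if i = j then 1 else 0)"
    and w: "w \<in> span (b ` I)"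
  shows "w = (\<Sum>i\<in>I. (w \<bullet> b i) *\<^sub>R b i)"
  using w
proof (induction rule: span_induct_alt)
  case base
  then show ?case by simp
next
  case (step c y z)
  then obtain j where j: "j \<in> I" "y = b j" by auto
  have "(\<Sum>i\<in>I. ((c *\<^sub>R y + z) \<bullet> b i) *\<^sub>R b i) =
        (\<Sum>i\<in>I. (c * (b j \<bullet> b i)) *\<^sub>R b i) + (\<Sum>i\<in>I. (z \<bullet> b i) *\<^sub>R b i)"
    by (simp add: j inner_add_left scaleR_add_left sum.distrib)
  also have "(\<Sum>i\<in>I. (c * (b j \<bullet> b i)) *\<^sub>R b i) = (\<Sum>i\<in>I. if i = j then c *\<^sub>R b j else 0)"
    by (intro sum.cong) (auto simp: on j)
  also have "\<dots> = c *\<^sub>R y"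
    using I j by simp
  finally show ?case
    using step(2) by simp
qed

text \<open>
  The reference point is the centre $t+\frac12\sum_i x_i$ of the unit cube: the ball of radius
  $1/2$ around it within the subspace lies in the cube, since a vector of norm at most $1/2$ has
  coordinates in $[-1/2,1/2]$ with respect to any orthonormal basis.
\<close>
lemma dk_set_contains_parallelepiped:
  fixes E :: "(real ^ 'n) set"
  assumes k: "1 \<le> k" "k \<le> CARD('n)"
    and x: "orthonormal_basis_choice k x" and E: "dk_set x k E"
    and v: "\<And>i. i < k \<Longrightarrow> norm (v i) \<le> 1 / (2 * real k)"
  obtains t where "\<And>r. (\<And>i. i < k \<Longrightarrow> r i \<in> {0..1}) \<Longrightarrow> t + (\<Sum>i<k. r i *\<^sub>R v i) \<in> E"
proof -
  have "card (v ` {..<k}) \<le> k"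
    using card_image_le[of "{..<k}" v] by simp
  then obtain s where s: "subspace s" "dim s = k" "v ` {..<k} \<subseteq> s"
    using subspace_of_dim_containing[of "v ` {..<k}" k] k by auto
  have sG: "s \<in> grassmannian k"
    using s by (simp add: grassmannian_def)
  have on: "\<And>i j. i \<in> {1..k} \<Longrightarrow> j \<in> {1..k} \<Longrightarrow> x s i \<bullet> x s j = (if i = j then 1 else 0)"
    and sp: "span (x s ` {1..k}) = s"
    using x sG by (auto simp: orthonormal_basis_choice_def)
  obtain t where t: "\<And>r. (\<forall>i\<in>{1..k}. r i \<in> {0..1}) \<Longrightarrow> t + (\<Sum>i=1..k. r i *\<^sub>R x s i) \<in> E"
    using E sG unfolding dk_set_def by blast
  show thesis
  proof (rule that)
    fix r :: "nat \<Rightarrow> real" assume r: "\<And>i. i < k \<Longrightarrow> r i \<in> {0..1}"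
    define w where "w = (\<Sum>i<k. r i *\<^sub>R v i)"
    have "w \<in> s"
      unfolding w_def using s by (intro subspace_sum subspace_scale) auto
    then have "w \<in> span (x s ` {1..k})"
      by (simp only: sp)
    then have w: "w = (\<Sum>i=1..k. (w \<bullet> x s i) *\<^sub>R x s i)"
      by (intro sum_orthonormal_representation on) auto
    have "norm w \<le> (\<Sum>i<k. norm (r i *\<^sub>R v i))"
      unfolding w_def by (rule norm_sum)
    also have "\<dots> \<le> (\<Sum>i<k. 1 * (1 / (2 * real k)))"
      unfolding norm_scaleR using r v by (intro sum_mono mult_mono) force+
    also have "\<dots> = 1 / 2"
      using k by simp
    finally have norm_w: "norm w \<le> 1 / 2" .
    have "1 / 2 + w \<bullet> x s i \<in> {0..1}" if "i \<in> {1..k}" for i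
    proof -
      have "norm (x s i) = 1"
        using on[OF that that] by (simp add: norm_eq_1)
      then have "\<bar>w \<bullet> x s i\<bar> \<le> 1 / 2"
        using Cauchy_Schwarz_ineq2[of w "x s i"] norm_w by simp
      then show ?thesis by (auto simp: abs_le_iff)
    qed
    then have "t + (\<Sum>i=1..k. (1 / 2 + w \<bullet> x s i) *\<^sub>R x s i) \<in> E"
      by (intro t) auto
    also have "t + (\<Sum>i=1..k. (1 / 2 + w \<bullet> x s i) *\<^sub>R x s i) =
        (t + (\<Sum>i=1..k. (1 / 2) *\<^sub>R x s i)) + w"
      by (subst (2) w) (simp only: scaleR_add_left sum.distrib add.assoc)
    finally show "(t + (\<Sum>i=1..k. (1 / 2) *\<^sub>R x s i)) + (\<Sum>i<k. r i *\<^sub>R v i) \<in> E"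
      by (simp add: w_def)
  qed
qed

section \<open>An edge density with integrable Fourier transform\<close>

text \<open>
  Vanishing at both end points makes the boundary terms of one integration by parts disappear, so
  that the Fourier transform decays like $t^{-2}$ and is integrable. The uniform density would give
  only $t^{-1}$ and lose a logarithm.
\<close>
definition bump :: "real \<Rightarrow> real" where
  "bump r = indicator {0..1} r * (6 * r * (1 - r))"

abbreviation bump_measure :: "real measure" where
  "bump_measure \<equiv> density lborel (\<lambda>r. ennreal (bump r))"

lemma bump_nonneg: "0 \<le> bump r"
  by (auto simp: bump_def indicator_def)

lemma bump_measurable [measurable]: "bump \<in> borel_measurable borel"
  unfolding bump_def by measurable

lemma real_distribution_bump: "real_distribution bump_measure"
proof -
  have "(\<integral>\<^sup>+r. ennreal (6 * r * (1 - r)) * indicator {0..1} r \<partial>lborel) = ennreal ((3 * 1^2 - 2 * 1^3) - (3 * 0^2 - 2 * 0^3))"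
    by (rule nn_integral_FTC_Icc)
       (auto intro!: derivative_eq_intros simp: algebra_simps power2_eq_square mult_left_le)
  moreover have "(\<integral>\<^sup>+r. ennreal (bump r) \<partial>lborel) =
      (\<integral>\<^sup>+r. ennreal (6 * r * (1 - r)) * indicator {0..1} r \<partial>lborel)"
    by (intro nn_integral_cong) (auto simp: bump_def indicator_def)
  ultimately have "(\<integral>\<^sup>+r. ennreal (bump r) \<partial>lborel) = 1"
    by simp
  then have "prob_space bump_measure"
    by (intro prob_spaceI) (simp add: emeasure_density)
  then show ?thesis
    by (simp add: real_distribution_def real_distribution_axioms_def)
qed

lemma AE_bump: "AE r in bump_measure. r \<in> {0..1}"
  by (subst AE_density) (auto simp: bump_def indicator_def)

text \<open>
  Two integrations by parts, carried out with an explicit antiderivative $G$. Combining them with the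
  trivial bound $1$ for small $t$ costs a factor of $2$ in the constant $36$.
\<close>
lemma char_bump_le: "cmod (char bump_measure t) \<le> 72 / (1 + t\<^sup>2)"
proof (cases "\<bar>t\<bar> \<le> 1")
  case True
  interpret real_distribution bump_measure by (rule real_distribution_bump)
  have "t\<^sup>2 \<le> 1"
    using True by (simp add: abs_square_le_1)
  then have "1 \<le> 72 / (1 + t\<^sup>2)"
    by (simp add: field_simps add_pos_nonneg)
  with cmod_char_le_1[of t] show ?thesis by linarith
next
  case False
  define a where "a = \<i> * complex_of_real t"
  have a0: "a \<noteq> 0" and na: "cmod a = \<bar>t\<bar>" and re: "Re a = 0"
    using False by (auto simp: a_def norm_mult)
  define g :: "real \<Rightarrow> complex" where "g r = 6 * of_real r * (1 - of_real r)" for r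
  define G where "G r = exp (a * of_real r) *
     (g r / a - (6 - 12 * of_real r) / a^2 - 12 / a^3)" for r
  have "char bump_measure t = (\<integral>r. bump r *\<^sub>R iexp (t * r) \<partial>lborel)"
    unfolding char_def by (subst integral_density) (auto simp: bump_nonneg)
  also have "\<dots> = (\<integral>r. indicator {0..1} r *\<^sub>R (g r * exp (a * of_real r)) \<partial>lborel)"
    by (intro Bochner_Integration.integral_cong)
       (auto simp: bump_def indicator_def g_def a_def scaleR_conv_of_real mult_ac)
  also have "\<dots> = G 1 - G 0"
  proof (rule integral_FTC_Icc)
    have "((\<lambda>r. exp (a * r) * (6 * r * (1 - r) / a - (6 - 12 * r) / a^2 - 12 / a^3))
        has_field_derivative (6 * z * (1 - z) * exp (a * z))) (at z)" for z :: complex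
      using a0
      by (auto intro!: derivative_eq_intros simp: divide_simps) (simp add: algebra_simps power2_eq_square power3_eq_cube)
    then have "((\<lambda>r. exp (a * r) * (6 * r * (1 - r) / a - (6 - 12 * r) / a^2 - 12 / a^3)) \<circ> complex_of_real
        has_vector_derivative 1 * (6 * of_real r * (1 - of_real r) * exp (a * of_real r))) (at r within {0..1})" for r :: real
      by (intro field_vector_diff_chain_within has_vector_derivative_of_real DERIV_ident)
         (auto intro: derivative_eq_intros has_field_derivative_at_within)
    then show "(G has_vector_derivative (g r * exp (a * of_real r))) (at r within {0..1})" for r
      by (simp add: G_def[abs_def] g_def o_def)
    show "continuous_on {0..1} (\<lambda>r. g r * exp (a * of_real r))"
      unfolding g_def by (intro continuous_intros)
  qed simp
  also have "G 1 - G 0 = exp a * (6 / a^2 - 12 / a^3) + (6 / a^2 + 12 / a^3)"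
    by (simp add: G_def g_def algebra_simps)
  also have "cmod \<dots> \<le> cmod (exp a) * (cmod (6 / a^2) + cmod (12 / a^3)) + (cmod (6 / a^2) + cmod (12 / a^3))"
    by (intro norm_triangle_mono order.refl norm_triangle_ineq)
       (simp add: norm_mult norm_triangle_ineq4 mult_left_mono)
  also have "\<dots> = 12 / t^2 + 24 / \<bar>t\<bar>^3"
    by (simp add: norm_divide norm_power na re)
  also have "\<dots> \<le> 12 / t^2 + 24 / t^2"
  proof -
    have "t^2 * 1 \<le> t^2 * \<bar>t\<bar>"
      using False by (intro mult_left_mono) auto
    then have "t^2 \<le> \<bar>t\<bar>^3"
      by (simp add: power3_eq_cube power2_eq_square mult.assoc)
    then show ?thesis
      using False by (intro add_left_mono divide_left_mono) auto
  qed
  also have "\<dots> = 36 / t^2" by simp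
  also have "36 / t\<^sup>2 = 72 / (t\<^sup>2 + t\<^sup>2)" by simp
  also have "\<dots> \<le> 72 / (1 + t\<^sup>2)"
  proof (rule divide_left_mono)
    have "1 \<le> t\<^sup>2"
      using False by (simp add: abs_square_less_1 not_le flip: not_less)
    then show "1 + t\<^sup>2 \<le> t\<^sup>2 + t\<^sup>2" "0 < (t\<^sup>2 + t\<^sup>2) * (1 + t\<^sup>2)"
      by (auto intro!: mult_pos_pos add_pos_nonneg)
  qed simp
  finally show ?thesis .
qed

lemma nn_integral_inverse_1_plus_sq: "(\<integral>\<^sup>+t. ennreal (1 / (1 + t\<^sup>2)) \<partial>lborel) \<le> ennreal pi"
proof -
  let ?f = "\<lambda>t::real. ennreal (1 / (1 + t\<^sup>2))"
  have half: "(\<integral>\<^sup>+t. ?f t * indicator {0..} t \<partial>lborel) = ennreal (pi / 2)"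
  proof -
    have "(\<integral>\<^sup>+t. ?f t * indicator {0..} t \<partial>lborel) = ennreal (pi / 2 - arctan 0)"
    proof (rule nn_integral_FTC_atLeast)
      show "DERIV arctan t :> 1 / (1 + t\<^sup>2)" for t
        using DERIV_arctan[of t] by (simp add: inverse_eq_divide)
      show "(arctan \<longlongrightarrow> pi / 2) at_top"
        by (rule tendsto_arctan_at_top)
    qed auto
    then show ?thesis by simp
  qed
  have "(\<integral>\<^sup>+t. ?f t \<partial>lborel) \<le> (\<integral>\<^sup>+t. ?f t * indicator {0..} t + ?f t * indicator {0..} (- t) \<partial>lborel)"
    by (intro nn_integral_mono) (auto simp: indicator_def)
  also have "\<dots> = (\<integral>\<^sup>+t. ?f t * indicator {0..} t \<partial>lborel) + (\<integral>\<^sup>+t. ?f t * indicator {0..} (- t) \<partial>lborel)"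
    by (rule nn_integral_add) auto
  also have "(\<integral>\<^sup>+t. ?f t * indicator {0..} (- t) \<partial>lborel) = (\<integral>\<^sup>+t. ?f t * indicator {0..} t \<partial>lborel)"
    using nn_integral_real_affine[of "\<lambda>t. ?f t * indicator {0..} (- t)" "-1" 0] by simp
  also have "(\<integral>\<^sup>+t. ?f t * indicator {0..} t \<partial>lborel) + (\<integral>\<^sup>+t. ?f t * indicator {0..} t \<partial>lborel) = ennreal pi"
    unfolding half by (subst ennreal_plus[symmetric]) auto
  finally show ?thesis .
qed

section \<open>Averaging over directions\<close>

lemma nn_integral_lborel_shift:
  fixes f :: "'a::euclidean_space \<Rightarrow> ennreal"
  assumes [measurable]: "f \<in> borel_measurable borel"
  shows "(\<integral>\<^sup>+v. f (v + a) \<partial>lborel) = (\<integral>\<^sup>+v. f v \<partial>lborel)"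
proof -
  have "(\<integral>\<^sup>+v. f v \<partial>lborel) = (\<integral>\<^sup>+v. f v \<partial>distr lborel borel ((+) a))"
    by (simp add: lborel_distr_plus)
  also have "\<dots> = (\<integral>\<^sup>+v. f (a + v) \<partial>lborel)"
    by (subst nn_integral_distr) auto
  finally show ?thesis
    by (simp add: add.commute)
qed

text \<open>
  Translating the ball by $ue$, where $e=\xi/|\xi|$ and
  $0\le u\le 1$, leaves it inside a ball with radius larger by $1$ and adds $u|\xi|$ to $\xi\cdot v$;
  averaging over $u$ replaces $f$ by its mean over an interval of length $|\xi|$, which is at most
  $|\xi|^{-1}\int f$.
\<close>
lemma nn_integral_ball_inner_le:
  fixes \<xi> :: "'a::euclidean_space" and f :: "real \<Rightarrow> ennreal"
  assumes [measurable]: "f \<in> borel_measurable borel" and "\<xi> \<noteq> 0"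
  shows "(\<integral>\<^sup>+v. indicator (ball 0 c) v * f (\<xi> \<bullet> v) \<partial>lborel) \<le>
    emeasure lborel (ball (0::'a) (c + 1)) * (ennreal (1 / norm \<xi>) * (\<integral>\<^sup>+t. f t \<partial>lborel))"
    (is "?L \<le> _")
proof -
  define e where "e = \<xi> /\<^sub>R norm \<xi>"
  have e: "norm e = 1" "\<xi> \<bullet> e = norm \<xi>"
    using \<open>\<xi> \<noteq> 0\<close> by (auto simp: e_def dot_square_norm power2_eq_square)
  have [measurable]: "ball (0::'a) r \<in> sets borel" for r
    by simp
  have slab: "(\<integral>\<^sup>+u. indicator {0..1} u * f (a + norm \<xi> * u) \<partial>lborel) \<le> ennreal (1 / norm \<xi>) * (\<integral>\<^sup>+t. f t \<partial>lborel)" for a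
  proof -
    have "(\<integral>\<^sup>+u. indicator {0..1} u * f (a + norm \<xi> * u) \<partial>lborel) \<le> (\<integral>\<^sup>+u. f (a + norm \<xi> * u) \<partial>lborel)"
      by (intro nn_integral_mono) (auto simp: indicator_def)
    also have "\<dots> = ennreal (1 / norm \<xi>) * (ennreal (norm \<xi>) * (\<integral>\<^sup>+u. f (a + norm \<xi> * u) \<partial>lborel))"
      using \<open>\<xi> \<noteq> 0\<close> by (simp flip: mult.assoc ennreal_mult)
    also have "ennreal (norm \<xi>) * (\<integral>\<^sup>+u. f (a + norm \<xi> * u) \<partial>lborel) = (\<integral>\<^sup>+t. f t \<partial>lborel)"
      using nn_integral_real_affine[of f "norm \<xi>" a] \<open>\<xi> \<noteq> 0\<close> by simp
    finally show ?thesis .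
  qed
  have shift: "?L \<le> (\<integral>\<^sup>+v. indicator (ball 0 (c + 1)) v * f (\<xi> \<bullet> v + norm \<xi> * u) \<partial>lborel)" if "u \<in> {0..1}" for u
  proof -
    have "?L = (\<integral>\<^sup>+v. indicator (ball 0 c) (v + u *\<^sub>R e) * f (\<xi> \<bullet> (v + u *\<^sub>R e)) \<partial>lborel)"
      by (rule nn_integral_lborel_shift[symmetric, where f = "\<lambda>v. indicator (ball 0 c) v * f (\<xi> \<bullet> v)"])
         (rule borel_measurable_times_ennreal, rule borel_measurable_indicator, simp, measurable)
    also have "\<dots> \<le> (\<integral>\<^sup>+v. indicator (ball 0 (c + 1)) v * f (\<xi> \<bullet> v + norm \<xi> * u) \<partial>lborel)"
    proof (rule nn_integral_mono)
      fix v :: 'a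
      have "norm v \<le> norm (v + u *\<^sub>R e) + norm (u *\<^sub>R e)"
        using norm_triangle_ineq4[of "v + u *\<^sub>R e" "u *\<^sub>R e"] by simp
      moreover have "norm (u *\<^sub>R e) \<le> 1"
        using that e by auto
      ultimately have "indicator (ball 0 c) (v + u *\<^sub>R e) \<le> (indicator (ball 0 (c + 1)) v :: ennreal)"
        by (auto simp: indicator_def)
      then show "indicator (ball 0 c) (v + u *\<^sub>R e) * f (\<xi> \<bullet> (v + u *\<^sub>R e)) \<le>
          indicator (ball 0 (c + 1)) v * f (\<xi> \<bullet> v + norm \<xi> * u)"
        by (simp add: inner_add_right e mult.commute[of u] mult_right_mono)
    qed
    finally show ?thesis .
  qed
  have "?L = (\<integral>\<^sup>+u. indicator {0..1::real} u * ?L \<partial>lborel)"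
    by (subst nn_integral_multc) (auto simp: nn_integral_indicator)
  also have "\<dots> \<le> (\<integral>\<^sup>+u. \<integral>\<^sup>+v. indicator {0..1} u * (indicator (ball 0 (c + 1)) v * f (\<xi> \<bullet> v + norm \<xi> * u)) \<partial>lborel \<partial>lborel)"
  proof (rule nn_integral_mono)
    fix u :: real
    show "indicator {0..1} u * ?L \<le>
        (\<integral>\<^sup>+v. indicator {0..1} u * (indicator (ball 0 (c + 1)) v * f (\<xi> \<bullet> v + norm \<xi> * u)) \<partial>lborel)"
      using shift[of u] by (cases "u \<in> {0..1}") auto
  qed
  also have "\<dots> = (\<integral>\<^sup>+v. \<integral>\<^sup>+u. indicator {0..1} u * (indicator (ball 0 (c + 1)) v * f (\<xi> \<bullet> v + norm \<xi> * u)) \<partial>lborel \<partial>lborel)"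
    by (rule lborel_pair.Fubini') (unfold case_prod_beta, measurable)
  also have "\<dots> = (\<integral>\<^sup>+v. indicator (ball 0 (c + 1)) v * (\<integral>\<^sup>+u. indicator {0..1} u * f (\<xi> \<bullet> v + norm \<xi> * u) \<partial>lborel) \<partial>lborel)"
    by (subst nn_integral_cmult[symmetric]) (auto simp: mult_ac)
  also have "\<dots> \<le> (\<integral>\<^sup>+v. indicator (ball (0::'a) (c + 1)) v * (ennreal (1 / norm \<xi>) * (\<integral>\<^sup>+t. f t \<partial>lborel)) \<partial>lborel)"
    by (intro nn_integral_mono mult_left_mono slab) auto
  also have "\<dots> = emeasure lborel (ball (0::'a) (c + 1)) * (ennreal (1 / norm \<xi>) * (\<integral>\<^sup>+t. f t \<partial>lborel))"
    by (subst nn_integral_multc) auto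
  finally show ?thesis .
qed

lemma emeasure_ball_pos_finite:
  assumes "r > 0"
  shows "emeasure lborel (ball (a::'a::euclidean_space) r) \<noteq> 0" "emeasure lborel (ball a r) \<noteq> \<infinity>"
  using assms unit_ball_vol_pos[of "DIM('a)"] by (auto simp: emeasure_ball ennreal_eq_0_iff mult_le_0_iff not_le)

definition ball_measure :: "real \<Rightarrow> 'a::euclidean_space measure" where
  "ball_measure r = uniform_measure lborel (ball 0 r)"

lemma sets_ball_measure [simp, measurable_cong]: "sets (ball_measure r) = sets borel"
  by (simp add: ball_measure_def)

lemma space_ball_measure [simp]: "space (ball_measure r) = UNIV"
  by (simp add: ball_measure_def)

lemma prob_space_ball_measure: "r > 0 \<Longrightarrow> prob_space (ball_measure r)"
  unfolding ball_measure_def by (intro prob_space_uniform_measure emeasure_ball_pos_finite)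

lemma nn_integral_ball_measure:
  fixes f :: "'a::euclidean_space \<Rightarrow> ennreal"
  assumes [measurable]: "f \<in> borel_measurable borel"
  shows "(\<integral>\<^sup>+v. f v \<partial>ball_measure r) = (\<integral>\<^sup>+v. indicator (ball 0 r) v * f v \<partial>lborel) / emeasure lborel (ball (0::'a) r)"
  unfolding ball_measure_def by (subst nn_integral_uniform_measure) (auto simp: mult.commute)

lemma ball_average_char_bump_decay:
  assumes "c > 0"
  obtains C where "C > 0" "\<And>\<xi>. \<xi> \<noteq> 0 \<Longrightarrow>
    (\<integral>v. cmod (char bump_measure (- 2 * pi * (\<xi> \<bullet> v))) \<partial>ball_measure c) \<le> C / norm (\<xi>::'a::euclidean_space)"
proof -
  interpret bump: real_distribution bump_measure by (rule real_distribution_bump)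
  interpret U: prob_space "ball_measure c :: 'a measure"
    using assms by (rule prob_space_ball_measure)
  define f where "f t = ennreal (cmod (char bump_measure (- 2 * pi * t)))" for t
  have f_meas [measurable]: "f \<in> borel_measurable borel"
    unfolding f_def by measurable
  define b where "b r = unit_ball_vol (DIM('a)) * r ^ DIM('a)" for r
  have b: "emeasure lborel (ball (0::'a) r) = ennreal (b r)" "b r > 0" if "r > 0" for r
    using that by (auto simp: b_def emeasure_ball)
  \<comment> \<open>$36 = 72\pi/(2\pi)$: the integral of the bound for the characteristic function, rescaled by $2\pi$.\<close>
  have int_f: "(\<integral>\<^sup>+t. f t \<partial>lborel) \<le> ennreal 36"
  proof -
    have eq: "(\<integral>\<^sup>+t. ennreal (cmod (char bump_measure t)) \<partial>lborel) = ennreal (2 * pi) * (\<integral>\<^sup>+t. f t \<partial>lborel)"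
      using nn_integral_real_affine[of "\<lambda>t. ennreal (cmod (char bump_measure t))" "- 2 * pi" 0] by (simp add: f_def)
    have char_le: "ennreal (cmod (char bump_measure t)) \<le> ennreal 72 * ennreal (1 / (1 + t\<^sup>2))" for t
      using char_bump_le[of t] by (simp del: ennreal_numeral flip: ennreal_mult)
    have "(\<integral>\<^sup>+t. f t \<partial>lborel) = ennreal (1 / (2 * pi)) * (ennreal (2 * pi) * (\<integral>\<^sup>+t. f t \<partial>lborel))"
      by (simp flip: mult.assoc ennreal_mult)
    also have "\<dots> = ennreal (1 / (2 * pi)) * (\<integral>\<^sup>+t. ennreal (cmod (char bump_measure t)) \<partial>lborel)"
      by (simp only: eq)
    also have "\<dots> \<le> ennreal (1 / (2 * pi)) * (\<integral>\<^sup>+t. ennreal 72 * ennreal (1 / (1 + t\<^sup>2)) \<partial>lborel)"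
      by (intro mult_left_mono nn_integral_mono char_le) simp
    also have "\<dots> = ennreal (1 / (2 * pi)) * (ennreal 72 * (\<integral>\<^sup>+t. ennreal (1 / (1 + t\<^sup>2)) \<partial>lborel))"
      by (subst nn_integral_cmult) auto
    also have "\<dots> \<le> ennreal (1 / (2 * pi)) * (ennreal 72 * ennreal pi)"
      by (intro mult_left_mono nn_integral_inverse_1_plus_sq) auto
    also have "\<dots> = ennreal 36"
      by (simp del: ennreal_numeral flip: ennreal_mult)
    finally show ?thesis .
  qed
  show thesis
  proof (rule that)
    show "36 * b (c + 1) / b c > 0"
      using assms b(2) by simp
    fix \<xi> :: 'a assume \<xi>: "\<xi> \<noteq> 0"
    have int: "integrable (ball_measure c) (\<lambda>v. cmod (char bump_measure (- 2 * pi * (\<xi> \<bullet> v))))"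
      by (intro U.integrable_const_bound[of _ 1] AE_I2) (auto simp: bump.cmod_char_le_1)
    have "ennreal (\<integral>v. cmod (char bump_measure (- 2 * pi * (\<xi> \<bullet> v))) \<partial>ball_measure c) =
        (\<integral>\<^sup>+v. f (\<xi> \<bullet> v) \<partial>ball_measure c)"
      unfolding f_def using int by (intro nn_integral_eq_integral[symmetric]) auto
    also have "\<dots> = (\<integral>\<^sup>+v. indicator (ball 0 c) v * f (\<xi> \<bullet> v) \<partial>lborel) / ennreal (b c)"
      using assms by (subst nn_integral_ball_measure) (auto simp: b)
    also have "\<dots> \<le> ennreal (b (c + 1)) * (ennreal (1 / norm \<xi>) * ennreal 36) / ennreal (b c)"
    proof (rule divide_right_mono_ennreal)
      have "(\<integral>\<^sup>+v. indicator (ball 0 c) v * f (\<xi> \<bullet> v) \<partial>lborel) \<le>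
          ennreal (b (c + 1)) * (ennreal (1 / norm \<xi>) * (\<integral>\<^sup>+t. f t \<partial>lborel))"
        using nn_integral_ball_inner_le[OF f_meas \<xi>, of c] b(1)[of "c + 1"] assms by simp
      also have "\<dots> \<le> ennreal (b (c + 1)) * (ennreal (1 / norm \<xi>) * ennreal 36)"
        by (intro mult_left_mono int_f) auto
      finally show "(\<integral>\<^sup>+v. indicator (ball 0 c) v * f (\<xi> \<bullet> v) \<partial>lborel) \<le>
          ennreal (b (c + 1)) * (ennreal (1 / norm \<xi>) * ennreal 36)" .
    qed
    also have "\<dots> = ennreal (36 * b (c + 1) / b c / norm \<xi>)"
      using assms b(2)[of c] b(2)[of "c + 1"] \<xi>
      by (simp add: divide_ennreal mult_ac del: ennreal_numeral flip: ennreal_mult)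
    finally show "(\<integral>v. cmod (char bump_measure (- 2 * pi * (\<xi> \<bullet> v))) \<partial>ball_measure c) \<le> 36 * b (c + 1) / b c / norm \<xi>"
      using assms b(2)[of c] b(2)[of "c + 1"] by (subst (asm) ennreal_le_iff) auto
  qed
qed

section \<open>A measure on the set with Fourier decay of order $k$\<close>

text \<open>
  The random parallelepiped construction: the edges $A_i$ are uniform in a ball, the position inside
  the parallelepiped has independent coordinates with the density \<open>bump\<close>, and integrating over the
  position first makes the unknown translation disappear in absolute values.
\<close>
lemma dk_set_carries_decaying_measure:
  fixes E :: "(real ^ 'n) set"
  assumes k: "1 \<le> k" "k \<le> CARD('n)" and x: "orthonormal_basis_choice k x"
    and E: "compact E" "dk_set x k E"
  obtains \<mu> C where "prob_space \<mu>" "sets \<mu> = sets borel" "emeasure \<mu> (- E) = 0" "C > 0"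
    "\<And>\<xi>. \<xi> \<noteq> 0 \<Longrightarrow> cmod (fourier_transform \<mu> \<xi>) \<le> C / norm \<xi> ^ k"
proof -
  define c where "c = 1 / (2 * real k)"
  have c: "c > 0" using k by (simp add: c_def)
  define U where "U = (ball_measure c :: (real ^ 'n) measure)"
  define P where "P = PiM {..<k} (\<lambda>_. U)"
  define Q where "Q = PiM {..<k} (\<lambda>_. bump_measure)"
  have sets_U [simp, measurable_cong]: "sets U = sets borel" and space_U [simp]: "space U = UNIV"
    by (simp_all add: U_def)
  interpret bump: real_distribution bump_measure by (rule real_distribution_bump)
  interpret U: prob_space U
    unfolding U_def using c by (rule prob_space_ball_measure)
  interpret PU: finite_product_prob_space "\<lambda>_. U" "{..<k}"
    by unfold_locales auto
  interpret PB: finite_product_prob_space "\<lambda>_. bump_measure" "{..<k}"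
    by unfold_locales auto
  interpret P: prob_space P unfolding P_def by (rule PU.prob_space_axioms)
  interpret Q: prob_space Q unfolding Q_def by (rule PB.prob_space_axioms)
  interpret PQ: pair_prob_space P Q ..

  \<comment> \<open>Closed set of all pairs of edges and admissible translations.\<close>
  define D where "D = (\<Inter>r\<in>{r. \<forall>i<k. r i \<in> {0..1::real}}.
      (\<lambda>p :: (nat \<Rightarrow> real ^ 'n) \<times> (real ^ 'n). snd p + (\<Sum>i<k. r i *\<^sub>R fst p i)) -` E)"
  have "continuous_on UNIV (\<lambda>p :: (nat \<Rightarrow> real ^ 'n) \<times> (real ^ 'n). fst p i)" for i
    by (rule continuous_on_compose2[OF continuous_on_product_coordinates continuous_on_fst[OF continuous_on_id]]) auto
  then have "closed D"
    unfolding D_def using E(1)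
    by (intro closed_INT ballI closed_vimage compact_imp_closed continuous_intros)
  moreover have "snd ` D \<subseteq> E"
    by (force simp: D_def dest!: bspec[where x = "\<lambda>_. 0"])
  ultimately obtain t where t_meas: "t \<in> borel_measurable borel"
    and t: "\<And>A u. (A, u) \<in> D \<Longrightarrow> (A, t A) \<in> D"
    using closed_set_borel_selection[OF _ E(1)] by blast
  have tE: "t A + (\<Sum>i<k. r i *\<^sub>R A i) \<in> E"
    if "\<forall>i<k. norm (A i) \<le> c" "\<forall>i<k. r i \<in> {0..1}" for A r
  proof -
    obtain u where "\<And>r. (\<And>i. i < k \<Longrightarrow> r i \<in> {0..1}) \<Longrightarrow> u + (\<Sum>i<k. r i *\<^sub>R A i) \<in> E"
    proof (rule dk_set_contains_parallelepiped[OF k x E(2), of A])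
      show "norm (A i) \<le> 1 / (2 * real k)" if "i < k" for i
        using \<open>\<forall>i<k. norm (A i) \<le> c\<close> that by (simp add: c_def)
    qed blast
    then have "(A, u) \<in> D"
      by (auto simp: D_def)
    then have "(A, t A) \<in> D"
      by (rule t)
    with that(2) show ?thesis
      by (auto simp: D_def)
  qed
  \<comment> \<open>Product measures live on extensional functions, whose values beyond $k$ are constant.\<close>
  have coord_P: "(\<lambda>A. A i) \<in> borel_measurable P" for i
  proof (cases "i < k")
    case True
    then have "(\<lambda>A. A i) \<in> measurable P U"
      unfolding P_def by (intro measurable_component_singleton) auto
    then show ?thesis by (simp cong: measurable_cong_sets)
  next
    case False
    then have "A i = undefined" if "A \<in> space P" for A
      using that by (auto simp: P_def space_PiM PiE_def extensional_def)
    then show ?thesis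
      by (subst measurable_cong[where g = "\<lambda>_. undefined"]) auto
  qed
  have coord_Q [measurable]: "(\<lambda>r. r i) \<in> borel_measurable Q" if "i \<in> {..<k}" for i
    using measurable_component_singleton[OF that, of "\<lambda>_. bump_measure"] unfolding Q_def
    by (simp cong: measurable_cong_sets)
  have [measurable]: "(\<lambda>A. A i) \<in> borel_measurable P" for i by (rule coord_P)
  have "(\<lambda>A. A) \<in> borel_measurable P"
    using coord_P by (rule measurable_coordinatewise_then_product)
  then have t_P [measurable]: "t \<in> borel_measurable P"
    using t_meas by (rule measurable_compose)
  define T where "T = (\<lambda>(A, r). t A + (\<Sum>i<k. r i *\<^sub>R A i))"
  have T [measurable]: "T \<in> borel_measurable (P \<Otimes>\<^sub>M Q)"
    unfolding T_def by measurable
  define \<mu> where "\<mu> = distr (P \<Otimes>\<^sub>M Q) borel T"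
  obtain C where C: "C > 0" "\<And>\<xi>. \<xi> \<noteq> 0 \<Longrightarrow>
      (\<integral>v. cmod (char bump_measure (- 2 * pi * (\<xi> \<bullet> v))) \<partial>U) \<le> C / norm \<xi>"
    using ball_average_char_bump_decay[OF c, where ?'a = "real ^ 'n"] unfolding U_def by blast
  show thesis
  proof (rule that)
    show "prob_space \<mu>"
      unfolding \<mu>_def by (rule PQ.prob_space_distr) (rule T)
    show "sets \<mu> = sets borel"
      by (simp add: \<mu>_def)
    show "C ^ k > 0"
      using C by simp
    have [measurable]: "E \<in> sets borel"
      using E by (simp add: borel_compact)
    have AE_P: "AE A in P. \<forall>i\<in>{..<k}. norm (A i) \<le> c"
    proof (rule AE_finite_allI)
      fix i assume "i \<in> {..<k}"
      moreover have "AE v in U. norm v \<le> c"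
        unfolding U_def ball_measure_def
        by (rule AE_uniform_measureI) auto
      ultimately show "AE A in P. norm (A i) \<le> c"
        unfolding P_def by (intro AE_PiM_component) (auto intro: U.prob_space_axioms)
    qed simp
    have AE_Q: "AE r in Q. \<forall>i\<in>{..<k}. r i \<in> {0..1}"
    proof (rule AE_finite_allI)
      fix i assume "i \<in> {..<k}"
      then show "AE r in Q. r i \<in> {0..1}"
        unfolding Q_def using AE_bump by (intro AE_PiM_component) (auto intro: bump.prob_space_axioms)
    qed simp
    have "AE r in Q. T (A, r) \<in> E" if A: "\<forall>i\<in>{..<k}. norm (A i) \<le> c" for A
      using AE_Q by eventually_elim (use A tE in \<open>auto simp: T_def\<close>)
    with AE_P have "AE A in P. AE r in Q. T (A, r) \<in> E"
      by (auto elim: AE_mp)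
    then have "AE w in P \<Otimes>\<^sub>M Q. T w \<in> E"
      by (intro PQ.AE_pair_measure) measurable
    then have "AE y in \<mu>. y \<in> E"
      unfolding \<mu>_def by (subst AE_distr_iff) auto
    then show "emeasure \<mu> (- E) = 0"
      by (subst (asm) AE_iff_measurable[of "- E"]) (auto simp: \<mu>_def)
    fix \<xi> :: "real ^ 'n" assume \<xi>: "\<xi> \<noteq> 0"
    define h where "h y = exp (- 2 * pi * \<i> * complex_of_real (\<xi> \<bullet> y))" for y
    have h_meas [measurable]: "h \<in> borel_measurable borel"
      unfolding h_def by measurable
    have norm_h: "cmod (h y) = 1" for y
      by (simp add: h_def)
    define q where "q v = char bump_measure (- 2 * pi * (\<xi> \<bullet> v))" for v
    have q_meas [measurable]: "q \<in> borel_measurable borel"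
      unfolding q_def by measurable
    have norm_q: "cmod (q v) \<le> 1" for v
      unfolding q_def by (rule bump.cmod_char_le_1)
    have inner: "(\<integral>r. h (T (A, r)) \<partial>Q) = h (t A) * (\<Prod>i<k. q (A i))" for A
    proof -
      have "h (T (A, r)) = h (t A) * (\<Prod>i<k. iexp (- 2 * pi * (\<xi> \<bullet> A i) * r i))" for r
      proof -
        have "- 2 * pi * \<i> * complex_of_real (\<xi> \<bullet> T (A, r)) =
            - 2 * pi * \<i> * complex_of_real (\<xi> \<bullet> t A) +
            (\<Sum>i<k. \<i> * complex_of_real (- 2 * pi * (\<xi> \<bullet> A i) * r i))"
          by (simp add: T_def inner_add_right inner_sum_right distrib_left sum_distrib_left
              sum_negf mult_ac)
        then show ?thesis
          unfolding h_def by (simp only: exp_add exp_sum finite_lessThan)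
      qed
      then have "(\<integral>r. h (T (A, r)) \<partial>Q) = h (t A) * (\<integral>r. (\<Prod>i<k. iexp (- 2 * pi * (\<xi> \<bullet> A i) * r i)) \<partial>Q)"
        by simp
      also have "(\<integral>r. (\<Prod>i<k. iexp (- 2 * pi * (\<xi> \<bullet> A i) * r i)) \<partial>Q) = (\<Prod>i<k. q (A i))"
        unfolding Q_def q_def char_def
        by (intro PB.product_integral_prod bump.integrable_iexp) auto
      finally show ?thesis .
    qed
    have "fourier_transform \<mu> \<xi> = (\<integral>w. h (T w) \<partial>(P \<Otimes>\<^sub>M Q))"
      unfolding fourier_transform_def \<mu>_def h_def[symmetric] by (rule integral_distr) measurable
    also have "\<dots> = (\<integral>A. \<integral>r. h (T (A, r)) \<partial>Q \<partial>P)"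
      by (intro PQ.integral_fst'[symmetric] PQ.integrable_const_bound[of _ 1]) (auto simp: norm_h)
    also have "cmod \<dots> \<le> (\<integral>A. cmod (\<integral>r. h (T (A, r)) \<partial>Q) \<partial>P)"
      by (rule integral_norm_bound)
    also have "\<dots> = (\<integral>A. (\<Prod>i<k. cmod (q (A i))) \<partial>P)"
      by (simp add: inner norm_mult norm_h prod_norm)
    also have "\<dots> = (\<Prod>i<k. \<integral>v. cmod (q v) \<partial>U)"
      unfolding P_def
      using q_meas
      by (intro PU.product_integral_prod U.integrable_const_bound[of _ 1])
         (auto simp: norm_q cong: measurable_cong_sets)
    also have "\<dots> \<le> (\<Prod>i<k. C / norm \<xi>)"
      unfolding q_def using C(2)[OF \<xi>] by (intro prod_mono) auto
    also have "\<dots> = C ^ k / norm \<xi> ^ k"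
      by (simp add: power_divide)
    finally show "cmod (fourier_transform \<mu> \<xi>) \<le> C ^ k / norm \<xi> ^ k" .
  qed
qed

section \<open>Autocorrelations and neighbourhoods of the support\<close>

text \<open>
  The autocorrelation of \<open>\<mu>\<close>: its transform $|\hat\mu|^2$ is nonnegative, and the mass that it gives
  to small balls measures how concentrated \<open>\<mu>\<close> is.
\<close>
definition difference_law :: "(real ^ 'n) measure \<Rightarrow> (real ^ 'n) measure" where
  "difference_law \<mu> = distr (\<mu> \<Otimes>\<^sub>M \<mu>) borel (\<lambda>(x, y). x - y)"

lemma sets_difference_law [simp, measurable_cong]: "sets (difference_law \<mu>) = sets borel"
  by (simp add: difference_law_def)

lemma prob_space_difference_law:
  assumes "prob_space \<mu>" and [measurable_cong]: "sets \<mu> = sets borel"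
  shows "prob_space (difference_law \<mu>)"
proof -
  interpret \<mu>: prob_space \<mu> by fact
  interpret pair_prob_space \<mu> \<mu> ..
  show ?thesis
    unfolding difference_law_def by (rule prob_space_distr) measurable
qed

lemma nn_integral_difference_law:
  assumes "prob_space \<mu>" and [measurable_cong]: "sets \<mu> = sets borel"
    and [measurable]: "f \<in> borel_measurable borel"
  shows "(\<integral>\<^sup>+z. f z \<partial>difference_law \<mu>) = (\<integral>\<^sup>+x. \<integral>\<^sup>+y. f (x - y) \<partial>\<mu> \<partial>\<mu>)"
proof -
  interpret \<mu>: prob_space \<mu> by fact
  show ?thesis
    unfolding difference_law_def by (simp add: nn_integral_distr \<mu>.nn_integral_fst[symmetric])
qed

lemma fourier_transform_le_1:
  assumes "prob_space \<mu>"
  shows "cmod (fourier_transform \<mu> \<xi>) \<le> 1"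
proof -
  interpret prob_space \<mu> by fact
  have "cmod (fourier_transform \<mu> \<xi>) \<le>
      (\<integral>x. cmod (exp (- 2 * pi * \<i> * complex_of_real (\<xi> \<bullet> x))) \<partial>\<mu>)"
    unfolding fourier_transform_def by (rule integral_norm_bound)
  then show ?thesis
    by (simp add: prob_space)
qed

lemma fourier_transform_measurable [measurable]:
  assumes "prob_space \<mu>" and [measurable_cong]: "sets \<mu> = sets borel"
  shows "fourier_transform \<mu> \<in> borel_measurable borel"
proof -
  interpret prob_space \<mu> by fact
  show ?thesis
    unfolding fourier_transform_def by measurable
qed

lemma fourier_transform_difference_law:
  assumes "prob_space \<mu>" and [measurable_cong]: "sets \<mu> = sets borel"
  shows "fourier_transform (difference_law \<mu>) \<xi> = complex_of_real ((cmod (fourier_transform \<mu> \<xi>))\<^sup>2)"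
proof -
  interpret \<mu>: prob_space \<mu> by fact
  interpret pair_prob_space \<mu> \<mu> ..
  define h where "h x = exp (- 2 * pi * \<i> * complex_of_real (\<xi> \<bullet> x))" for x
  have [measurable]: "h \<in> borel_measurable borel"
    unfolding h_def by measurable
  have [measurable]: "cnj \<in> borel_measurable borel"
    by (intro borel_measurable_continuous_onI continuous_intros)
  have h: "h (x - y) = h x * cnj (h y)" for x y
    by (simp add: h_def inner_diff_right algebra_simps exp_cnj flip: exp_add)
  have norm_h: "cmod (h x) = 1" for x
    by (simp add: h_def)
  have F: "fourier_transform \<mu> \<xi> = (\<integral>x. h x \<partial>\<mu>)"
    by (simp add: fourier_transform_def h_def)
  have "fourier_transform (difference_law \<mu>) \<xi> = (\<integral>z. h z \<partial>difference_law \<mu>)"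
    by (simp add: fourier_transform_def h_def)
  also have "\<dots> = (\<integral>w. h (fst w) * cnj (h (snd w)) \<partial>(\<mu> \<Otimes>\<^sub>M \<mu>))"
    unfolding difference_law_def by (subst integral_distr) (auto simp: case_prod_beta h)
  also have "\<dots> = (\<integral>x. \<integral>y. h x * cnj (h y) \<partial>\<mu> \<partial>\<mu>)"
    by (subst integral_fst'[symmetric])
       (auto intro!: integrable_const_bound[of _ 1] simp: norm_mult norm_h)
  also have "\<dots> = (\<integral>x. h x \<partial>\<mu>) * cnj (\<integral>x. h x \<partial>\<mu>)"
    by (simp add: integral_cnj)
  also have "\<dots> = complex_of_real ((cmod (fourier_transform \<mu> \<xi>))\<^sup>2)"
    by (simp only: F complex_norm_square)
  finally show ?thesis .
qed

lemma integral_fourier_transform_swap: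
  assumes "prob_space \<mu>" and [measurable_cong]: "sets \<mu> = sets borel"
    and "prob_space \<nu>" and [measurable_cong]: "sets \<nu> = sets borel"
  shows "(\<integral>\<xi>. fourier_transform \<mu> \<xi> \<partial>\<nu>) = (\<integral>x. fourier_transform \<nu> x \<partial>\<mu>)"
proof -
  interpret \<mu>: prob_space \<mu> by fact
  interpret \<nu>: prob_space \<nu> by fact
  interpret pair_prob_space \<mu> \<nu> ..
  show ?thesis
    unfolding fourier_transform_def
    by (subst Fubini_integral)
       (auto intro!: integrable_const_bound[of _ 1] simp: inner_commute case_prod_beta)
qed

text \<open>
  The symmetry of $\int\hat\mu\,d\nu=\int\hat\nu\,d\mu$, applied to difference laws. It
  takes the place of the Plancherel theorem.
\<close>
lemma difference_law_parseval:
  assumes \<mu>: "prob_space \<mu>" "sets \<mu> = sets borel" and \<nu>: "prob_space \<nu>" "sets \<nu> = sets borel"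
  shows "(\<integral>\<^sup>+\<xi>. ennreal ((cmod (fourier_transform \<mu> \<xi>))\<^sup>2) \<partial>difference_law \<nu>) =
    (\<integral>\<^sup>+x. ennreal ((cmod (fourier_transform \<nu> x))\<^sup>2) \<partial>difference_law \<mu>)"
proof -
  have int: "integrable (difference_law \<nu>) (\<lambda>\<xi>. (cmod (fourier_transform \<mu> \<xi>))\<^sup>2)"
    if \<mu>: "prob_space \<mu>" "sets \<mu> = sets borel" and \<nu>: "prob_space \<nu>" "sets \<nu> = sets borel"
    for \<mu> \<nu> :: "(real ^ 'a) measure"
  proof -
    interpret D: prob_space "difference_law \<nu>"
      using \<nu> by (rule prob_space_difference_law)
    have [measurable]: "fourier_transform \<mu> \<in> borel_measurable borel"
      using \<mu> by (rule fourier_transform_measurable)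
    show ?thesis
      by (rule D.integrable_const_bound[of _ 1])
         (auto simp: power_le_one fourier_transform_le_1[OF \<mu>(1)])
  qed
  have "complex_of_real (\<integral>\<xi>. (cmod (fourier_transform \<mu> \<xi>))\<^sup>2 \<partial>difference_law \<nu>) =
      complex_of_real (\<integral>x. (cmod (fourier_transform \<nu> x))\<^sup>2 \<partial>difference_law \<mu>)"
    using integral_fourier_transform_swap[OF prob_space_difference_law[OF \<mu>] sets_difference_law
        prob_space_difference_law[OF \<nu>] sets_difference_law]
    by (simp only: fourier_transform_difference_law \<mu> \<nu> integral_complex_of_real)
  then show ?thesis
    by (simp add: nn_integral_eq_integral int \<mu> \<nu>)
qed

text \<open>
  For such $z$ and $|v|\le R$ the phase $2\pi z\cdot v$ is at most $\pi/3$ in absolute value, so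
  the integrand has real part at least $1/2$.
\<close>
lemma fourier_transform_ball_measure_ge:
  fixes z :: "real ^ 'n"
  assumes R: "R > 0" and z: "norm z \<le> 1 / (6 * R)"
  shows "1 / 4 \<le> (cmod (fourier_transform (ball_measure R) z))\<^sup>2"
proof -
  interpret U: prob_space "ball_measure R :: (real ^ 'n) measure"
    using R by (rule prob_space_ball_measure)
  let ?h = "\<lambda>v. exp (- 2 * pi * \<i> * complex_of_real (z \<bullet> v))"
  have int: "integrable (ball_measure R) ?h"
    by (rule U.integrable_const_bound[of _ 1]) (auto cong: measurable_cong_sets)
  have "AE v in ball_measure R. 1 / 2 \<le> Re (?h v)"
    unfolding ball_measure_def
  proof (rule AE_uniform_measureI, simp, rule AE_I2, rule impI)
    fix v :: "real ^ 'n" assume v: "v \<in> ball 0 R"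
    have "\<bar>z \<bullet> v\<bar> \<le> norm z * norm v"
      by (rule Cauchy_Schwarz_ineq2)
    also have "\<dots> \<le> 1 / (6 * R) * R"
      using z v R by (intro mult_mono) auto
    also have "\<dots> = 1 / 6"
      using R by simp
    finally have "2 * pi * \<bar>z \<bullet> v\<bar> \<le> 2 * pi * (1 / 6)"
      by (intro mult_left_mono) auto
    then have "cos (pi / 3) \<le> cos (2 * pi * \<bar>z \<bullet> v\<bar>)"
      by (intro cos_monotone_0_pi_le) auto
    also have "cos (2 * pi * \<bar>z \<bullet> v\<bar>) = Re (?h v)"
      by (simp add: Re_exp abs_if)
    finally show "1 / 2 \<le> Re (?h v)"
      by (simp add: cos_60)
  qed
  then have "1 / 2 \<le> (\<integral>v. Re (?h v) \<partial>ball_measure R)"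
    using int by (intro U.integral_ge_const) auto
  also have "\<dots> = Re (fourier_transform (ball_measure R) z)"
    unfolding fourier_transform_def by (rule integral_Re[OF int])
  also have "\<dots> \<le> cmod (fourier_transform (ball_measure R) z)"
    by (rule complex_Re_le_cmod)
  finally have "(1 / 2)\<^sup>2 \<le> (cmod (fourier_transform (ball_measure R) z))\<^sup>2"
    by (intro power_mono) auto
  then show ?thesis
    by (simp add: power2_eq_square)
qed

lemma nn_integral_difference_law_ball_measure_le:
  fixes f :: "real ^ 'n \<Rightarrow> ennreal"
  assumes [measurable]: "f \<in> borel_measurable borel" and R: "R > 0"
  shows "(\<integral>\<^sup>+z. f z \<partial>difference_law (ball_measure R)) \<le>
    (\<integral>\<^sup>+z. f z \<partial>lborel) / emeasure lborel (ball (0 :: real ^ 'n) R)"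
proof -
  interpret U: prob_space "ball_measure R :: (real ^ 'n) measure"
    using R by (rule prob_space_ball_measure)
  have avg: "(\<integral>\<^sup>+y. f (x - y) \<partial>ball_measure R) \<le> (\<integral>\<^sup>+z. f z \<partial>lborel) / emeasure lborel (ball (0 :: real ^ 'n) R)" for x
  proof -
    have "(\<integral>\<^sup>+y. indicator (ball 0 R) y * f (x - y) \<partial>lborel) \<le> (\<integral>\<^sup>+y. f (x - y) \<partial>lborel)"
      by (intro nn_integral_mono) (auto simp: indicator_def)
    also have "\<dots> = (\<integral>\<^sup>+y. f (x - y) \<partial>distr lborel borel (\<lambda>y. x + (-1) *\<^sub>R y))"
      by (subst lborel_affine[of "-1" x]) (simp_all add: density_1)
    also have "\<dots> = (\<integral>\<^sup>+z. f z \<partial>lborel)"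
      by (subst nn_integral_distr) auto
    finally show ?thesis
      by (subst nn_integral_ball_measure) (auto intro: divide_right_mono_ennreal)
  qed
  have "(\<integral>\<^sup>+x. \<integral>\<^sup>+y. f (x - y) \<partial>ball_measure R \<partial>ball_measure R) \<le>
      (\<integral>\<^sup>+x. (\<integral>\<^sup>+z. f z \<partial>lborel) / emeasure lborel (ball (0 :: real ^ 'n) R) \<partial>(ball_measure R :: (real ^ 'n) measure))"
    by (intro nn_integral_mono avg)
  also have "\<dots> = (\<integral>\<^sup>+z. f z \<partial>lborel) / emeasure lborel (ball (0 :: real ^ 'n) R)"
    by (simp add: U.emeasure_space_1[unfolded space_ball_measure])
  finally show ?thesis
    by (subst nn_integral_difference_law) (auto intro: U.prob_space_axioms)
qed

text \<open>
  With $U$ uniform on the ball of radius $R$, the function $|\hat U|^2$ is at least $1/4$ on the ball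
  of radius $1/(6R)$, so $\frac14$ of the mass in question is at most the integral of $|\hat U|^2$ against
  the difference law of \<open>\<mu>\<close>. By the exchange formula this is the integral of $|\hat\mu|^2$ against
  the difference law of $U$, whose density is at most the reciprocal of the volume of the ball.
\<close>
lemma difference_law_cball_le:
  fixes \<mu> :: "(real ^ 'n) measure"
  assumes \<mu>: "prob_space \<mu>" "sets \<mu> = sets borel" and R: "R > 0"
  shows "emeasure (difference_law \<mu>) (cball 0 (1 / (6 * R))) * emeasure lborel (ball (0 :: real ^ 'n) R) \<le>
    4 * (\<integral>\<^sup>+\<xi>. ennreal ((cmod (fourier_transform \<mu> \<xi>))\<^sup>2) \<partial>lborel)"
    (is "?m * ?b \<le> 4 * ?I")
proof -
  let ?U = "ball_measure R :: (real ^ 'n) measure"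
  have U: "prob_space ?U"
    using R by (rule prob_space_ball_measure)
  have [measurable]: "fourier_transform \<mu> \<in> borel_measurable borel"
    using \<mu> by (rule fourier_transform_measurable)
  have "ennreal (1 / 4) * ?m = (\<integral>\<^sup>+z. ennreal (1 / 4) * indicator (cball 0 (1 / (6 * R))) z \<partial>difference_law \<mu>)"
    by (subst nn_integral_cmult_indicator) auto
  also have "\<dots> \<le> (\<integral>\<^sup>+z. ennreal ((cmod (fourier_transform ?U z))\<^sup>2) \<partial>difference_law \<mu>)"
    using fourier_transform_ball_measure_ge[OF R]
    by (intro nn_integral_mono) (auto simp: indicator_def intro!: ennreal_leI simp del: ennreal_numeral)
  also have "\<dots> = (\<integral>\<^sup>+\<xi>. ennreal ((cmod (fourier_transform \<mu> \<xi>))\<^sup>2) \<partial>difference_law ?U)"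
    using U by (intro difference_law_parseval \<mu>) auto
  also have "\<dots> \<le> ?I / ?b"
    by (intro nn_integral_difference_law_ball_measure_le R) measurable
  finally have "ennreal (1 / 4) * ?m * ?b \<le> ?I / ?b * ?b"
    by (rule mult_right_mono) simp
  also have "?I / ?b * ?b = ?I"
    using emeasure_ball_pos_finite[OF R, of "0 :: real ^ 'n"] by (simp add: ennreal_divide_times ennreal_divide_self less_top)
  finally have "ennreal 4 * (ennreal (1 / 4) * (?m * ?b)) \<le> ennreal 4 * ?I"
    by (intro mult_left_mono) (auto simp: mult_ac)
  then show ?thesis
    by (simp add: mult.assoc[symmetric] del: ennreal_numeral flip: ennreal_mult) simp
qed

text \<open>
  Let $f(x)=\mu(B(x,r))$, which vanishes outside \<open>W\<close>. Its integral is the volume $b$ of an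
  \<open>r\<close>-ball, and its square integrates to at most $b$ times the probability that two independent points
  have distance at most $2r$. Cauchy--Schwarz gives $b^2\le\int f^2\cdot|W|$.
\<close>
lemma emeasure_neighbourhood_ge:
  fixes \<mu> :: "(real ^ 'n) measure"
  assumes \<mu>: "prob_space \<mu>" and sets_\<mu> [measurable_cong]: "sets \<mu> = sets borel" and r: "r > 0"
    and E: "emeasure \<mu> (- E) = 0" "E \<in> sets borel" and W: "open W" "(\<Union>x\<in>E. ball x r) \<subseteq> W"
  shows "emeasure lborel (ball (0 :: real ^ 'n) r) \<le> emeasure (difference_law \<mu>) (cball 0 (2 * r)) * emeasure lborel W"
proof -
  interpret \<mu>: prob_space \<mu> by fact
  interpret L: pair_sigma_finite lborel \<mu> ..
  let ?b = "emeasure lborel (ball (0 :: real ^ 'n) r)"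
  define near where "near x y = (indicator (ball 0 r) (x - y) :: ennreal)" for x y :: "real ^ 'n"
  define g where "g y = (\<integral>\<^sup>+y'. indicator (cball 0 (2 * r)) (y - y') \<partial>\<mu>)" for y
  define f where "f x = (\<integral>\<^sup>+y. near x y \<partial>\<mu>)" for x
  have [measurable]: "ball 0 r \<in> sets (borel :: (real ^ 'n) measure)" "cball 0 (2 * r) \<in> sets (borel :: (real ^ 'n) measure)"
    by auto
  have [measurable]: "(\<lambda>(x, y). near x y) \<in> borel_measurable (borel \<Otimes>\<^sub>M borel)"
    unfolding near_def by measurable
  have [measurable]: "f \<in> borel_measurable borel" "g \<in> borel_measurable borel"
    unfolding f_def g_def by measurable
  have [measurable]: "W \<in> sets borel" using W by simp
  have near_int: "(\<integral>\<^sup>+x. near x y \<partial>lborel) = ?b" for y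
    using nn_integral_lborel_shift[of "indicator (ball 0 r)" "- y"] by (simp add: near_def)
  have f_int: "(\<integral>\<^sup>+x. f x \<partial>lborel) = ?b"
  proof -
    have "(\<integral>\<^sup>+x. f x \<partial>lborel) = (\<integral>\<^sup>+y. \<integral>\<^sup>+x. near x y \<partial>lborel \<partial>\<mu>)"
      unfolding f_def by (rule L.Fubini'[symmetric]) measurable
    then show ?thesis
      by (simp add: near_int \<mu>.emeasure_space_1)
  qed
  have f_sq: "(\<integral>\<^sup>+x. (f x)\<^sup>2 \<partial>lborel) \<le> ?b * emeasure (difference_law \<mu>) (cball 0 (2 * r))"
  proof -
    have f_le: "(f x)\<^sup>2 \<le> (\<integral>\<^sup>+y. near x y * g y \<partial>\<mu>)" for x
    proof -
      have "(f x)\<^sup>2 = (\<integral>\<^sup>+y. near x y * f x \<partial>\<mu>)"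
        by (subst nn_integral_multc) (auto simp: f_def power2_eq_square)
      also have "\<dots> \<le> (\<integral>\<^sup>+y. near x y * g y \<partial>\<mu>)"
      proof (rule nn_integral_mono)
        fix y
        have "f x \<le> g y" if "x - y \<in> ball 0 r"
          unfolding f_def g_def
        proof (rule nn_integral_mono)
          fix y'
          have "norm (y - y') \<le> norm (x - y') + norm (x - y)"
            using norm_triangle_ineq4[of "x - y'" "x - y"] by (simp add: algebra_simps)
          then show "near x y' \<le> indicator (cball 0 (2 * r)) (y - y')"
            using that by (auto simp: near_def indicator_def)
        qed
        then show "near x y * f x \<le> near x y * g y"
          by (auto simp: near_def indicator_def)
      qed
      finally show ?thesis .
    qed
    have "(\<integral>\<^sup>+x. (f x)\<^sup>2 \<partial>lborel) \<le> (\<integral>\<^sup>+x. \<integral>\<^sup>+y. near x y * g y \<partial>\<mu> \<partial>lborel)"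
      by (intro nn_integral_mono f_le)
    also have "\<dots> = (\<integral>\<^sup>+y. \<integral>\<^sup>+x. near x y * g y \<partial>lborel \<partial>\<mu>)"
      by (rule L.Fubini'[symmetric]) measurable
    also have "\<dots> = (\<integral>\<^sup>+y. ?b * g y \<partial>\<mu>)"
      by (subst nn_integral_multc) (auto simp: near_int)
    also have "\<dots> = ?b * (\<integral>\<^sup>+y. g y \<partial>\<mu>)"
      by (rule nn_integral_cmult) measurable
    also have "(\<integral>\<^sup>+y. g y \<partial>\<mu>) = emeasure (difference_law \<mu>) (cball 0 (2 * r))"
      unfolding g_def
      by (subst nn_integral_difference_law[symmetric, OF \<mu> sets_\<mu>]) auto
    finally show ?thesis .
  qed
  have AE_E: "AE y in \<mu>. y \<in> E"
    using E by (intro AE_I[of _ _ "- E"]) (auto simp: sets_\<mu>)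
  have f_supp: "f x = f x * indicator W x" for x
  proof (cases "x \<in> W")
    case False
    have "AE y in \<mu>. near x y = 0"
      using AE_E
    proof eventually_elim
      case (elim y)
      then have "x \<notin> ball y r" using W False by blast
      then show ?case by (auto simp: near_def indicator_def dist_norm norm_minus_commute)
    qed
    then have "f x = (\<integral>\<^sup>+y. 0 \<partial>\<mu>)"
      unfolding f_def by (intro nn_integral_cong_AE)
    with False show ?thesis by simp
  qed simp
  have "?b * ?b = (\<integral>\<^sup>+x. f x * indicator W x \<partial>lborel)\<^sup>2"
    by (simp add: f_int power2_eq_square flip: f_supp)
  also have "\<dots> \<le> (\<integral>\<^sup>+x. (f x)\<^sup>2 \<partial>lborel) * (\<integral>\<^sup>+x. (indicator W x)\<^sup>2 \<partial>lborel)"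
    by (rule Cauchy_Schwarz_nn_integral) measurable
  also have "(\<integral>\<^sup>+x. (indicator W x)\<^sup>2 \<partial>lborel) = emeasure lborel W"
    by (subst nn_integral_indicator[symmetric]) (auto intro!: nn_integral_cong simp: indicator_def simp del: nn_integral_indicator)
  also have "(\<integral>\<^sup>+x. (f x)\<^sup>2 \<partial>lborel) * emeasure lborel W \<le>
      ?b * emeasure (difference_law \<mu>) (cball 0 (2 * r)) * emeasure lborel W"
    by (intro mult_right_mono f_sq) simp
  finally show ?thesis
    using emeasure_ball_pos_finite[OF r, of "0 :: real ^ 'n"]
    by (subst (asm) mult.assoc) (simp add: ennreal_mult_le_mult_iff)
qed

section \<open>Positive Lebesgue measure from square integrable transforms\<close>

text \<open>
  On the shell $2^m\le|\xi|<2^{m+1}$ the function is $O(2^{-m(d+1)})$ while the shell has volume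
  $O(2^{md})$, so the shells contribute a geometric series.
\<close>
lemma nn_integral_finite_if_decay:
  fixes f :: "'a::euclidean_space \<Rightarrow> real"
  assumes f1: "\<And>\<xi>. f \<xi> \<le> 1" and f2: "\<And>\<xi>. 1 \<le> norm \<xi> \<Longrightarrow> f \<xi> \<le> C / norm \<xi> ^ Suc DIM('a)"
    and C: "0 \<le> C"
  shows "(\<integral>\<^sup>+\<xi>. ennreal (f \<xi>) \<partial>lborel) < \<infinity>"
proof -
  define n where "n = DIM('a)"
  define V where "V = unit_ball_vol (real n)"
  have V: "V > 0" by (simp add: V_def)
  have ball: "emeasure lborel (ball (0::'a) r) = ennreal (V * r ^ n)" if "r \<ge> 0" for r
    using that by (simp add: V_def n_def emeasure_ball)
  have term_le: "h m \<le> (\<Sum>m. h m)" for h :: "nat \<Rightarrow> ennreal" and m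
    using sum_le_suminf[of h "{m}"] by simp
  have le: "ennreal (f \<xi>) \<le> indicator (ball 0 1) \<xi> +
      (\<Sum>m. ennreal (C / (2 ^ m) ^ Suc n) * indicator (ball 0 (2 ^ Suc m)) \<xi>)" for \<xi>
  proof (cases "norm \<xi> < 1")
    case True
    then show ?thesis
      using f1[of \<xi>] by (intro add_increasing2) auto
  next
    case False
    define m where "m = (LEAST m. norm \<xi> < 2 ^ Suc m)"
    obtain j where "norm \<xi> < 2 ^ j"
      using real_arch_pow[of 2 "norm \<xi>"] by auto
    also have "(2::real) ^ j \<le> 2 ^ Suc j" by simp
    finally have m1: "norm \<xi> < 2 ^ Suc m"
      unfolding m_def by (rule LeastI)
    have m2: "2 ^ m \<le> norm \<xi>"
    proof (cases m)
      case (Suc i)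
      then have "\<not> norm \<xi> < 2 ^ Suc i"
        using not_less_Least[of i "\<lambda>m. norm \<xi> < 2 ^ Suc m"] by (simp add: m_def)
      with Suc show ?thesis by simp
    qed (use False in simp)
    have "f \<xi> \<le> C / norm \<xi> ^ Suc n"
      using f2[of \<xi>] False by (simp add: n_def)
    also have "\<dots> \<le> C / (2 ^ m) ^ Suc n"
      using m2 C False by (intro divide_left_mono power_mono mult_pos_pos zero_less_power) auto
    finally have "ennreal (f \<xi>) \<le> ennreal (C / (2 ^ m) ^ Suc n) * indicator (ball 0 (2 ^ Suc m)) \<xi>"
      using m1 by (simp add: ennreal_leI del: power_Suc)
    also have "\<dots> \<le> (\<Sum>m. ennreal (C / (2 ^ m) ^ Suc n) * indicator (ball 0 (2 ^ Suc m)) \<xi>)"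
      by (rule term_le)
    finally show ?thesis
      by (intro add_increasing) auto
  qed
  define g where "g m \<xi> = ennreal (C / (2 ^ m) ^ Suc n) * indicator (ball (0::'a) (2 ^ Suc m)) \<xi>" for m \<xi>
  have g [measurable]: "g m \<in> borel_measurable borel" for m
    unfolding g_def by (intro borel_measurable_times_ennreal borel_measurable_const borel_measurable_indicator) simp
  have "(\<integral>\<^sup>+\<xi>. ennreal (f \<xi>) \<partial>lborel) \<le> (\<integral>\<^sup>+\<xi>. indicator (ball 0 1) \<xi> + (\<Sum>m. g m \<xi>) \<partial>lborel)"
    unfolding g_def by (intro nn_integral_mono le)
  also have "\<dots> = (\<integral>\<^sup>+\<xi>. indicator (ball (0::'a) 1) \<xi> \<partial>lborel) + (\<integral>\<^sup>+\<xi>. (\<Sum>m. g m \<xi>) \<partial>lborel)"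
    by (rule nn_integral_add) (auto intro!: borel_measurable_indicator)
  also have "(\<integral>\<^sup>+\<xi>. (\<Sum>m. g m \<xi>) \<partial>lborel) = (\<Sum>m. \<integral>\<^sup>+\<xi>. g m \<xi> \<partial>lborel)"
    by (rule nn_integral_suminf) simp
  also have "(\<lambda>m. \<integral>\<^sup>+\<xi>. g m \<xi> \<partial>lborel) =
      (\<lambda>m. ennreal (C / (2 ^ m) ^ Suc n) * emeasure lborel (ball (0::'a) (2 ^ Suc m)))"
    unfolding g_def by (subst nn_integral_cmult_indicator) auto
  also have "(\<lambda>m. ennreal (C / (2 ^ m) ^ Suc n) * emeasure lborel (ball (0::'a) (2 ^ Suc m))) =
      (\<lambda>m. ennreal (C * V * 2 ^ n * (1 / 2) ^ m))"
  proof
    fix m :: nat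
    have "C / (2 ^ m) ^ Suc n * (V * (2 ^ Suc m) ^ n) = C * V * 2 ^ n * (1 / 2) ^ m"
      by (simp add: power_mult_distrib field_simps)
    then show "ennreal (C / (2 ^ m) ^ Suc n) * emeasure lborel (ball (0::'a) (2 ^ Suc m)) =
        ennreal (C * V * 2 ^ n * (1 / 2) ^ m)"
      using C V by (subst ball) (auto simp del: power_Suc simp flip: ennreal_mult)
  qed
  also have "(\<Sum>m. ennreal (C * V * 2 ^ n * (1 / 2) ^ m)) = ennreal (\<Sum>m. C * V * 2 ^ n * (1 / 2) ^ m)"
    using C V by (intro suminf_ennreal2 summable_mult summable_geometric) auto
  also have "(\<integral>\<^sup>+\<xi>. indicator (ball (0::'a) 1) \<xi> \<partial>lborel) + \<dots> < \<infinity>"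
    by (simp add: ball)
  finally show ?thesis .
qed

text \<open>
  The two estimates for the difference law, taken at the scales $r$ and $R=1/(12r)$, have matching
  powers of $r$. They bound the volume of every open set around $E$ below by a positive number
  depending only on the dimension and the $L^2$-norm, which outer regularity excludes for a null set.
\<close>
lemma emeasure_pos_if_fourier_transform_L2:
  fixes \<mu> :: "(real ^ 'n) measure"
  assumes \<mu>: "prob_space \<mu>" "sets \<mu> = sets borel" and E: "compact E" "emeasure \<mu> (- E) = 0"
    and L2: "(\<integral>\<^sup>+\<xi>. ennreal ((cmod (fourier_transform \<mu> \<xi>))\<^sup>2) \<partial>lborel) < \<infinity>"
  shows "emeasure lborel E > 0"
proof (rule ccontr)
  assume "\<not> emeasure lborel E > 0"
  then have null: "emeasure lborel E = 0" by simp
  have E_borel: "E \<in> sets borel"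
    using E by (simp add: borel_compact)
  define n where "n = CARD('n)"
  define V where "V = unit_ball_vol (real n)"
  have V: "V > 0" by (simp add: V_def)
  have ball: "emeasure lborel (ball (0::real ^ 'n) r) = ennreal (V * r ^ n)" if "r \<ge> 0" for r
    using that by (simp add: V_def n_def emeasure_ball)
  obtain I where I: "I \<ge> 0" "(\<integral>\<^sup>+\<xi>. ennreal ((cmod (fourier_transform \<mu> \<xi>))\<^sup>2) \<partial>lborel) = ennreal I"
    using L2 by (auto simp: less_top_ennreal)
  define d where "d = V\<^sup>2 / 12 ^ n"
  have d: "d > 0" using V by (simp add: d_def)
  have lower: "ennreal d \<le> ennreal (4 * I) * emeasure lborel W" if W: "open W" "E \<subseteq> W" for W
  proof -
    obtain r where r: "r > 0" "(\<Union>x\<in>E. ball x r) \<subseteq> W"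
      using compact_subset_open_imp_ball_epsilon_subset[OF E(1) W] by blast
    define R where "R = 1 / (12 * r)"
    have R: "R > 0" "1 / (6 * R) = 2 * r" using r by (simp_all add: R_def)
    let ?m = "emeasure (difference_law \<mu>) (cball 0 (2 * r))"
    have "V * r ^ n * (V * R ^ n) = V\<^sup>2 * (r * R) ^ n"
      by (simp add: power_mult_distrib power2_eq_square)
    also have "r * R = 1 / 12" using r by (simp add: R_def)
    finally have "ennreal d = emeasure lborel (ball (0::real ^ 'n) r) * emeasure lborel (ball (0::real ^ 'n) R)"
      using V r R by (simp add: ball d_def power_divide flip: ennreal_mult)
    also have "\<dots> \<le> (?m * emeasure lborel W) * emeasure lborel (ball (0::real ^ 'n) R)"
      by (intro mult_right_mono emeasure_neighbourhood_ge[OF \<mu> r(1) E(2) E_borel W(1) r(2)]) simp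
    also have "\<dots> = (?m * emeasure lborel (ball (0::real ^ 'n) R)) * emeasure lborel W"
      by (simp add: mult_ac)
    also have "\<dots> \<le> (4 * ennreal I) * emeasure lborel W"
      using difference_law_cball_le[OF \<mu> R(1)] by (intro mult_right_mono) (auto simp: R I)
    also have "4 * ennreal I = ennreal (4 * I)"
      using I by (simp add: ennreal_mult)
    finally show ?thesis .
  qed
  \<comment> \<open>Adding $1$ covers the case $I = 0$ and makes the final inequality strict.\<close>
  define e where "e = d / (4 * I + 1)"
  have e: "e > 0" using d I by (simp add: e_def)
  obtain W where W: "open W" "E \<subseteq> W" "emeasure lborel (W - E) < e"
    using outer_regular_lborel[OF E_borel e] .
  have "emeasure lborel W = emeasure lborel (W - E)"
    using W E_borel null by (subst emeasure_Diff_null_set) (auto simp: null_sets_def)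
  with W have "emeasure lborel W \<le> ennreal e" by simp
  then have "ennreal (4 * I) * emeasure lborel W \<le> ennreal (4 * I) * ennreal e"
    by (intro mult_left_mono) auto
  with lower[OF W(1,2)] have "ennreal d \<le> ennreal (4 * I * e)"
    using I e by (simp add: ennreal_mult)
  then have "d \<le> 4 * I * e"
    using I e by (subst (asm) ennreal_le_iff) auto
  moreover have "e * (4 * I + 1) = d"
    using I by (simp add: e_def)
  then have "d = 4 * I * e + e"
    by (simp add: algebra_simps)
  ultimately show False using e by simp
qed

section \<open>Fourier dimension of compact $(d,k)$-sets\<close>

lemma fourier_dim_ge:
  fixes \<mu> :: "(real ^ 'n) measure"
  assumes "0 \<le> s" "s \<le> real CARD('n)" "prob_space \<mu>" "sets \<mu> = sets borel" "emeasure \<mu> (- E) = 0" "C > 0"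
    and "\<And>\<xi>. \<xi> \<noteq> 0 \<Longrightarrow> cmod (fourier_transform \<mu> \<xi>) \<le> C * norm \<xi> powr (- s / 2)"
  shows "s \<le> fourier_dim E"
  unfolding fourier_dim_def
  by (rule cSup_upper) (use assms in \<open>auto intro!: bdd_aboveI[of _ "real CARD('n)"]\<close>)

lemma fourier_dim_eq_card:
  fixes \<mu> :: "(real ^ 'n) measure"
  assumes "prob_space \<mu>" "sets \<mu> = sets borel" "emeasure \<mu> (- E) = 0" "C > 0"
    and "\<And>\<xi>. \<xi> \<noteq> 0 \<Longrightarrow> cmod (fourier_transform \<mu> \<xi>) \<le> C * norm \<xi> powr (- real CARD('n) / 2)"
  shows "fourier_dim E = real CARD('n)"
  unfolding fourier_dim_def
  by (rule cSup_eq_maximum) (use assms in auto)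

theorem corollary2p4:
  fixes E :: "(real ^ 'n) set"
    and x :: "(real ^ 'n) set \<Rightarrow> nat \<Rightarrow> real ^ 'n"
    and k :: nat
  assumes "CARD('n) \<ge> 2"
    and "1 \<le> k" and "k < CARD('n)"
    and "orthonormal_basis_choice k x"
    and "compact E"
    and "dk_set x k E"
  shows "(real k \<le> real CARD('n) / 2 \<longrightarrow> fourier_dim E \<ge> 2 * real k) \<and>
         (real k > real CARD('n) / 2 \<longrightarrow>
            fourier_dim E = real CARD('n) \<and> emeasure lebesgue E > 0)"
proof -
  obtain \<mu> C where \<mu>: "prob_space \<mu>" "sets \<mu> = sets borel" "emeasure \<mu> (- E) = 0" and C: "C > 0"
    and decay: "\<And>\<xi>. \<xi> \<noteq> 0 \<Longrightarrow> cmod (fourier_transform \<mu> \<xi>) \<le> C / norm \<xi> ^ k"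
    using dk_set_carries_decaying_measure[of k x E] assms by auto
  have powr_k: "norm \<xi> powr (- real k) = 1 / norm \<xi> ^ k" if "\<xi> \<noteq> 0" for \<xi> :: "real ^ 'n"
    using that by (simp add: powr_minus_divide powr_realpow)
  have le_1: "cmod (fourier_transform \<mu> \<xi>) \<le> 1" for \<xi>
    using \<mu>(1) by (rule fourier_transform_le_1)
  show ?thesis
  proof (intro conjI impI)
    assume "real k \<le> real CARD('n) / 2"
    then show "2 * real k \<le> fourier_dim E"
    proof (intro fourier_dim_ge[OF _ _ \<mu> C])
      fix \<xi> :: "real ^ 'n" assume "\<xi> \<noteq> 0"
      then show "cmod (fourier_transform \<mu> \<xi>) \<le> C * norm \<xi> powr (- (2 * real k) / 2)"
        using decay[of \<xi>] powr_k[of \<xi>] by simp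
    qed simp_all
  next
    assume k: "real CARD('n) / 2 < real k"
    \<comment> \<open>Only large $|\xi|$ needs the decay; for $|\xi|<1$ the required bound exceeds the trivial bound $1$.\<close>
    show "fourier_dim E = real CARD('n)"
    proof (rule fourier_dim_eq_card[OF \<mu>])
      show "C + 1 > 0" using C by simp
      fix \<xi> :: "real ^ 'n" assume \<xi>: "\<xi> \<noteq> 0"
      let ?p = "norm \<xi> powr (- real CARD('n) / 2)"
      show "cmod (fourier_transform \<mu> \<xi>) \<le> (C + 1) * ?p"
      proof (cases "1 \<le> norm \<xi>")
        case True
        have "C / norm \<xi> ^ k = C * norm \<xi> powr (- real k)"
          using powr_k[OF \<xi>] by simp
        also have "\<dots> \<le> (C + 1) * ?p"
          using True C k by (intro mult_mono powr_mono) auto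
        finally show ?thesis using decay[OF \<xi>] by linarith
      next
        case False
        then have "1 powr (- real CARD('n) / 2) \<le> ?p"
          using \<xi> by (intro powr_mono2') auto
        then have "1 * 1 \<le> (C + 1) * ?p"
          using C by (intro mult_mono) auto
        with le_1[of \<xi>] show ?thesis by linarith
      qed
    qed
    have L2: "(\<integral>\<^sup>+\<xi>. ennreal ((cmod (fourier_transform \<mu> \<xi>))\<^sup>2) \<partial>lborel) < \<infinity>"
    proof (rule nn_integral_finite_if_decay)
      show "(cmod (fourier_transform \<mu> \<xi>))\<^sup>2 \<le> 1" for \<xi>
        using le_1 by (simp add: power_le_one)
      fix \<xi> :: "real ^ 'n" assume \<xi>: "1 \<le> norm \<xi>"
      then have "(cmod (fourier_transform \<mu> \<xi>))\<^sup>2 \<le> (C / norm \<xi> ^ k)\<^sup>2"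
        by (intro power_mono decay) auto
      also have "\<dots> = C\<^sup>2 / norm \<xi> ^ (2 * k)"
        by (simp add: power_divide power_mult mult.commute flip: power_mult)
      also have "\<dots> \<le> C\<^sup>2 / norm \<xi> ^ Suc DIM(real ^ 'n)"
        using \<xi> k by (intro divide_left_mono power_increasing mult_pos_pos zero_less_power) auto
      finally show "(cmod (fourier_transform \<mu> \<xi>))\<^sup>2 \<le> C\<^sup>2 / norm \<xi> ^ Suc DIM(real ^ 'n)" .
    qed simp
    have "emeasure lborel E > 0"
      using emeasure_pos_if_fourier_transform_L2[OF \<mu>(1,2) assms(5) \<mu>(3) L2] .
    then show "emeasure lebesgue E > 0"
      using assms(5) by (simp add: borel_compact)
  qed
qed

end
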